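(* Let $K\subset\mathbb{R}^3$ be a given polygonal knot with $n$ edges. The number of knot types obtainable by polygonal inversion of $K$, that is, the number of distinct knot types that arise as $\hat\rho[\mathbf{p},r](K)$ over all radii $r>0$ and all centers $\mathbf{p}\in\mathbb{R}^3$ that are not vertices of $K$ (counting those cases in which $\hat\rho[\mathbf{p},r](K)$ is an embedded polygon), is at most $$\frac{1}{24}\left(n^6-9n^5+21n^4+9n^3-22n^2-96n\right).$$
   Context: A polygonal knot with $n$ edges is a simple closed polygon in $\mathbb{R}^3$ with cyclically ordered vertices $v_1,\dots,v_n$ and edges the segments $[v_i,v_{i+1}]$ (indices mod $n$). Knot type means isotopy class of knots in $\mathbb{R}^3$; mirror images are distinguished. For $\mathbf{p}\in\mathbb{R}^3$ and $r>0$, inversion in the sphere of radius $r$ centered at $\mathbf{p}$ is the map $\rho[\mathbf{p},r](\mathbf{x})=\mathbf{p}+\frac{r^2(\mathbf{x}-\mathbf{p})}{|\mathbf{x}-\mathbf{p}|^2}$ on $\mathbb{R}^3\setminus\{\mathbf{p}\}$. Polygonal inversion: if no vertex of $K$ equals $\mathbf{p}$, then $\hat\rho[\mathbf{p},r](K)$ is the closed polygon obtained by connecting the successive points $\rho[\mathbf{p},r](v_1),\dots,\rho[\mathbf{p},r](v_n)$ (cyclically) by straight line segments. It may be self-intersecting; it has a knot type only when it is embedded.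
   Formalization: The number of edges n is assumed to be at least 4: for n = 3 the bound equals 0, while inverting a triangle centered at a point off its plane gives an embedded triangle, so one knot type (the unknot) always occurs. *)

theory Defs
  imports "HOL-Analysis.Analysis"
begin

text \<open>A closed polygon is given by the list of its cyclically ordered vertices. Three consecutive
  vertices are allowed to be collinear.\<close>

definition polygon_edge :: "(real^3) list \<Rightarrow> nat \<Rightarrow> (real^3) set" where
  "polygon_edge vs i = closed_segment (vs ! i) (vs ! (Suc i mod length vs))"

definition closed_polygon :: "(real^3) list \<Rightarrow> (real^3) set" where
  "closed_polygon vs = (\<Union>i<length vs. polygon_edge vs i)"

text \<open>For distinct vertices the last clause says that adjacent edges share only their common vertex
  and that all other pairs of edges are disjoint.\<close>

definition polygonal_knot :: "(real^3) list \<Rightarrow> bool" where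
  "polygonal_knot vs \<longleftrightarrow>
     length vs \<ge> 3 \<and> distinct vs \<and>
     (\<forall>i<length vs. \<forall>j<length vs. i \<noteq> j \<longrightarrow>
        polygon_edge vs i \<inter> polygon_edge vs j =
          {vs ! i, vs ! (Suc i mod length vs)} \<inter> {vs ! j, vs ! (Suc j mod length vs)})"

text \<open>Isotopy of knots is ambient: a path of self-homeomorphisms of space that starts at the identity
  and carries one knot onto the other. In particular no reflection is involved, so mirror images
  may have different types. Knots are unoriented subsets of space.\<close>

definition ambient_isotopic :: "(real^3) set \<Rightarrow> (real^3) set \<Rightarrow> bool" where
  "ambient_isotopic K L \<longleftrightarrow>
     (\<exists>f. homotopic_with_canon (\<lambda>h. \<exists>g. homeomorphism UNIV UNIV h g) UNIV UNIV id f \<and> f ` K = L)"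

definition knot_type :: "(real^3) set \<Rightarrow> (real^3) set set" where
  "knot_type K = {L. ambient_isotopic K L}"

definition sphere_inversion :: "real^3 \<Rightarrow> real \<Rightarrow> real^3 \<Rightarrow> real^3" where
  "sphere_inversion p r x = p + (r\<^sup>2 / (norm (x - p))\<^sup>2) *\<^sub>R (x - p)"

definition polygonal_inversion :: "real^3 \<Rightarrow> real \<Rightarrow> (real^3) list \<Rightarrow> (real^3) list" where
  "polygonal_inversion p r vs = map (sphere_inversion p r) vs"

definition inversion_knot_types :: "(real^3) list \<Rightarrow> (real^3) set set set" where
  "inversion_knot_types vs =
     {knot_type (closed_polygon (polygonal_inversion p r vs)) | p r.
        r > 0 \<and> p \<notin> set vs \<and> polygonal_knot (polygonal_inversion p r vs)}"

end

(*
  If p lies on no sphere or plane through the endpoints of two disjoint edges, inverting at p keeps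
  the polygon embedded: a crossing of two inverted edges is an affine dependency between inverted
  vertices, and rescaling its weights by the squared distances to p gives a crossing of the original
  edges, because a quadric through the four vertices that avoids p forces the weights to balance.
  The radius only rescales the image, and small perturbations of the vertices of an embedded polygon
  are realised by an ambient isotopy, so the knot type is constant on each region of the arrangement
  of the m = n(n-3)/2 quadrics, and an embedded inversion centred on one of the quadrics has the type
  of some adjacent region. An arrangement of m spheres or planes in space has at most
  m(m^2 - 3m + 8)/3 regions: removing one more sphere adds at most as many regions as the traces
  of the others cut out on it, and stereographic projection turns these traces into circles in the
  plane.
*)

theory Submission imports Defs
begin

section \<open>Counting pieces by clopen subsets\<close>

text \<open>Components are never handled directly. Clopen sets form a vector space over the field
  with two elements under symmetric difference, whose dimension is the number of components when
  that is finite, and continuous maps pull them back; so a bound on their number passes through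
  images and cuts without naming a component. Cutting along a sphere is then a rank argument: a
  locally constant function off the sphere has a jump across it, and the difference of two functions
  with the same jump extends across.

  Spheres and planes are kept as zero sets of
  \<open>A * (x \<bullet> x) + b \<bullet> x + C\<close>, because inversion about \<open>q\<close>
  swaps the leading coefficient with the value of the polynomial at \<open>q\<close>. A centre off a
  quadric thus gives it a nonzero leading coefficient, and a centre on it flattens it. On a circle
  the latter turns a quadratic equation into a linear one, which makes up for the circle being
  opened into a line.

  The quadric through four vertices is not unique when they lie on a common circle or line; any
  nonzero one serves, since the crossing argument uses only that it contains the vertices and avoids
  the centre.\<close>

definition clopens :: "'a::topological_space set \<Rightarrow> 'a set set" where
  "clopens X = {A. openin (top_of_set X) A \<and> closedin (top_of_set X) A}"

text \<open>Having at most \<open>k\<close> components, expressed through the number of clopen subsets, which is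
  submultiplicative under the constructions below.\<close>

definition pieces_le :: "'a::topological_space set \<Rightarrow> nat \<Rightarrow> bool" where
  "pieces_le X k \<longleftrightarrow> finite (clopens X) \<and> card (clopens X) \<le> 2 ^ k"

lemma clopens_iff:
  "A \<in> clopens X \<longleftrightarrow> A \<subseteq> X \<and> openin (top_of_set X) A \<and> openin (top_of_set X) (X - A)"
  by (auto simp: clopens_def closedin_def)

lemma clopens_subset: "A \<in> clopens X \<Longrightarrow> A \<subseteq> X"
  by (simp add: clopens_iff)

lemma clopens_Compl: "A \<in> clopens X \<Longrightarrow> X - A \<in> clopens X"
  by (auto simp: clopens_iff double_diff)

lemma clopens_sym_diff:
  assumes "A \<in> clopens X" "B \<in> clopens X"
  shows "(A - B) \<union> (B - A) \<in> clopens X"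
  using assms unfolding clopens_def by (auto intro!: openin_diff closedin_diff)

lemma clopens_open_iff:
  assumes "open X"
  shows "A \<in> clopens X \<longleftrightarrow> A \<subseteq> X \<and> open A \<and> open (X - A)"
  using assms by (auto simp: clopens_iff openin_open_eq)

lemma clopens_connected:
  assumes "A \<in> clopens X" "connected S" "S \<subseteq> X"
  shows "S \<subseteq> A \<or> S \<inter> A = {}"
proof -
  obtain V where V: "open V" "A = X \<inter> V"
    using assms(1) by (auto simp: clopens_iff openin_open)
  obtain W where W: "open W" "X - A = X \<inter> W"
    using assms(1) by (auto simp: clopens_iff openin_open)
  have "V \<inter> S = {} \<or> W \<inter> S = {}"
    by (rule connectedD[OF assms(2) V(1) W(1)]) (use V W assms(3) in auto)
  then show ?thesis using V W assms(3) by auto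
qed

lemma pieces_le_mono: "pieces_le X j \<Longrightarrow> j \<le> k \<Longrightarrow> pieces_le X k"
  unfolding pieces_le_def by (meson le_trans one_le_numeral power_increasing)

lemma pieces_le_inj:
  assumes "inj_on F (clopens X)" "F ` clopens X \<subseteq> clopens Y" "pieces_le Y k"
  shows "pieces_le X k"
  using assms unfolding pieces_le_def
  by (meson card_inj_on_le finite_imageD finite_subset le_trans)

text \<open>A set version of rank-nullity: sets in the same fibre of \<open>J\<close> differ by the
  trace of a clopen subset of \<open>U\<close>, so \<open>U\<close> bounds each fibre and
  \<open>Z\<close> the number of fibres. Instead of additivity of \<open>J\<close>, a representative
  \<open>R\<close> is fixed in each fibre; the fibre together with the difference from its
  representative determines the set.\<close>

lemma pieces_le_add:
  assumes J: "\<And>A. A \<in> clopens X \<Longrightarrow> J A \<in> clopens Z"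
    and ext: "\<And>A B. A \<in> clopens X \<Longrightarrow> B \<in> clopens X \<Longrightarrow> J A = J B \<Longrightarrow>
                 \<exists>C\<in>clopens U. C \<inter> X = (A - B) \<union> (B - A)"
    and U: "pieces_le U j" and Z: "pieces_le Z k"
  shows "pieces_le X (j + k)"
proof -
  define R where "R z = (SOME B. B \<in> clopens X \<and> J B = z)" for z
  have R: "R (J A) \<in> clopens X \<and> J (R (J A)) = J A" if "A \<in> clopens X" for A
    unfolding R_def by (rule someI) (use that in auto)
  have "\<exists>H. \<forall>A\<in>clopens X. H A \<in> clopens U \<and> H A \<inter> X = (A - R (J A)) \<union> (R (J A) - A)"
    by (intro bchoice ballI) (use ext R in \<open>metis\<close>)
  then obtain H where H: "\<And>A. A \<in> clopens X \<Longrightarrow> H A \<in> clopens U"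
    "\<And>A. A \<in> clopens X \<Longrightarrow> H A \<inter> X = (A - R (J A)) \<union> (R (J A) - A)" by blast
  have inj: "inj_on (\<lambda>A. (H A, J A)) (clopens X)"
  proof (rule inj_onI)
    fix A B assume AB: "A \<in> clopens X" "B \<in> clopens X" "(H A, J A) = (H B, J B)"
    then have "(A - R (J A)) \<union> (R (J A) - A) = (B - R (J A)) \<union> (R (J A) - B)"
      using H(2) by (metis prod.inject)
    then show "A = B" by blast
  qed
  have sub: "(\<lambda>A. (H A, J A)) ` clopens X \<subseteq> clopens U \<times> clopens Z"
    using H J by auto
  have fin: "finite (clopens U \<times> clopens Z)"
    using U Z by (auto simp: pieces_le_def)
  have "card (clopens X) \<le> card (clopens U \<times> clopens Z)"
    by (rule card_inj_on_le[OF inj sub fin])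
  also have "\<dots> \<le> 2 ^ j * 2 ^ k"
    using U Z by (auto simp: pieces_le_def card_cartesian_product intro: mult_le_mono)
  finally show ?thesis
    using inj_on_finite[OF inj sub fin] by (simp add: pieces_le_def power_add)
qed

lemma pieces_le_connected:
  assumes "connected X" shows "pieces_le X 1"
proof -
  have "clopens X \<subseteq> {{}, X}"
    using clopens_connected[OF _ assms order_refl] by (auto dest: clopens_subset)
  then have "finite (clopens X)" "card (clopens X) \<le> card {{}, X}"
    by (auto intro: finite_subset card_mono)
  moreover have "card {{}, X} \<le> 2" by (simp add: card_insert_if)
  ultimately show ?thesis by (simp add: pieces_le_def)
qed

lemma pieces_le_empty: "pieces_le ({} :: 'a::topological_space set) k"
proof -
  have *: "clopens {} = {{}::'a set}" by (auto simp: clopens_iff)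
  show ?thesis unfolding pieces_le_def * by simp
qed

lemma pieces_le_Un:
  assumes "pieces_le X j" "pieces_le Y k"
  shows "pieces_le (X \<union> Y) (j + k)"
proof -
  have o: "openin (top_of_set V) (V \<inter> B)" if B: "openin (top_of_set (X \<union> Y)) B" and V: "V \<subseteq> X \<union> Y" for B V
  proof -
    obtain T where T: "open T" "B = (X \<union> Y) \<inter> T" using B unfolding openin_open by blast
    then have "V \<inter> B = V \<inter> T" using V by blast
    then show ?thesis using T(1) by (simp add: openin_open_Int)
  qed
  have *: "A \<inter> V \<in> clopens V" if "A \<in> clopens (X \<union> Y)" "V \<subseteq> X \<union> Y" for A V
  proof -
    have "openin (top_of_set V) (V \<inter> A)" "openin (top_of_set V) (V \<inter> (X \<union> Y - A))"
      using that unfolding clopens_iff by (intro o; blast)+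
    moreover have "V \<inter> (X \<union> Y - A) = V - A \<inter> V" using that by blast
    ultimately show ?thesis unfolding clopens_iff by (simp add: Int_commute)
  qed
  have inj: "inj_on (\<lambda>A. (A \<inter> X, A \<inter> Y)) (clopens (X \<union> Y))"
    by (rule inj_onI) (auto dest!: clopens_subset)
  have sub: "(\<lambda>A. (A \<inter> X, A \<inter> Y)) ` clopens (X \<union> Y) \<subseteq> clopens X \<times> clopens Y"
    using * by auto
  have fin: "finite (clopens X \<times> clopens Y)"
    using assms by (auto simp: pieces_le_def)
  have "card (clopens (X \<union> Y)) \<le> card (clopens X \<times> clopens Y)"
    by (rule card_inj_on_le[OF inj sub fin])
  also have "\<dots> \<le> 2 ^ j * 2 ^ k"
    using assms by (auto simp: pieces_le_def card_cartesian_product intro: mult_le_mono)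
  finally show ?thesis
    using inj_on_finite[OF inj sub fin] by (simp add: pieces_le_def power_add)
qed

text \<open>Preimages of clopen sets are clopen, and taking them is injective: the difference of two
  clopen sets is relatively open, so if it is nonempty it meets the dense image.\<close>

lemma pieces_le_dense_image:
  assumes g: "continuous_on Y g" and im: "g ` Y \<subseteq> X" and dense: "X \<subseteq> closure (g ` Y)"
    and Y: "pieces_le Y k"
  shows "pieces_le X k"
proof (rule pieces_le_inj[OF _ _ Y])
  let ?F = "\<lambda>A. {y \<in> Y. g y \<in> A}"
  show "?F ` clopens X \<subseteq> clopens Y"
  proof clarsimp
    fix A assume A: "A \<in> clopens X"
    have *: "openin (top_of_set Y) {y \<in> Y. g y \<in> B}" if "openin (top_of_set X) B" for B
    proof -
      have "openin (top_of_set Y) (Y \<inter> g -` B)"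
        using continuous_on_open_gen[of g Y X] im g that by blast
      moreover have "Y \<inter> g -` B = {y \<in> Y. g y \<in> B}" by auto
      ultimately show ?thesis by simp
    qed
    have "Y - {y \<in> Y. g y \<in> A} = {y \<in> Y. g y \<in> X - A}" using im by auto
    then show "{y \<in> Y. g y \<in> A} \<in> clopens Y"
      using A *[of A] *[of "X - A"] unfolding clopens_iff by auto
  qed
  have sub: "A \<subseteq> B" if A: "A \<in> clopens X" "B \<in> clopens X" and eq: "?F A = ?F B" for A B
  proof (rule ccontr)
    assume "\<not> A \<subseteq> B"
    then obtain x where x: "x \<in> A - B" by auto
    have "openin (top_of_set X) (A - B)" using A by (auto simp: clopens_def intro: openin_diff)
    then obtain V where V: "open V" "A - B = X \<inter> V" by (auto simp: openin_open)
    have "x \<in> closure (g ` Y)" using x A dense by (auto dest!: clopens_subset)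
    then have "V \<inter> g ` Y \<noteq> {}" 
      using open_Int_closure_eq_empty[OF V(1), of "g ` Y"] V(2) x by auto
    then obtain y where "y \<in> Y" "g y \<in> V" by auto
    then have "g y \<in> A - B" using V im by auto
    then show False using eq \<open>y \<in> Y\<close> by auto
  qed
  show "inj_on ?F (clopens X)"
  proof (rule inj_onI)
    fix A B assume AB: "A \<in> clopens X" "B \<in> clopens X" "?F A = ?F B"
    show "A = B" using sub[OF AB] sub[OF AB(2,1) AB(3)[symmetric]] by (rule subset_antisym)
  qed
qed

text \<open>Every set of values has a clopen preimage, so the power set of the range embeds into the
  clopen sets; comparing powers of two turns the bound on clopen sets into a bound on
  values.\<close>

lemma pieces_le_locally_constant:
  fixes f :: "'a::topological_space \<Rightarrow> 'b"
  assumes X: "pieces_le X k"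
    and loc: "\<And>x. x \<in> X \<Longrightarrow> \<exists>V. open V \<and> x \<in> V \<and> (\<forall>y\<in>V \<inter> X. f y = f x)"
  shows "finite (f ` X) \<and> card (f ` X) \<le> k"
proof -
  let ?F = "\<lambda>S. {x \<in> X. f x \<in> S}"
  have op: "openin (top_of_set X) (?F S)" for S
  proof (subst openin_subopen, intro ballI)
    fix x assume x: "x \<in> ?F S"
    then obtain V where V: "open V" "x \<in> V" "\<forall>y\<in>V \<inter> X. f y = f x" using loc by blast
    have "openin (top_of_set X) (X \<inter> V)" using V(1) by (rule openin_open_Int)
    moreover have "x \<in> X \<inter> V" using V(2) x by fast
    moreover have "f y \<in> S" if "y \<in> X \<inter> V" for y
    proof -
      have "f y = f x" using V(3) that by blast
      then show ?thesis using x by simp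
    qed
    then have "X \<inter> V \<subseteq> ?F S" by blast
    ultimately show "\<exists>T. openin (top_of_set X) T \<and> x \<in> T \<and> T \<subseteq> ?F S" by blast
  qed
  have "?F S \<in> clopens X" for S
  proof -
    have "X - ?F S = ?F (- S)" by auto
    then show ?thesis using op[of S] op[of "-S"] by (auto simp: clopens_iff)
  qed
  then have sub: "?F ` Pow (f ` X) \<subseteq> clopens X" by auto
  have inj: "inj_on ?F (Pow (f ` X))"
  proof (rule inj_onI)
    fix S T assume "S \<in> Pow (f ` X)" "T \<in> Pow (f ` X)" "?F S = ?F T"
    then have "\<forall>x\<in>X. f x \<in> S \<longleftrightarrow> f x \<in> T" "S \<subseteq> f ` X" "T \<subseteq> f ` X" by blast+
    then show "S = T" by blast
  qed
  have fin: "finite (clopens X)" using X by (simp add: pieces_le_def)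
  have "finite (Pow (f ` X))" using inj_on_finite[OF inj sub fin] .
  then have f: "finite (f ` X)" by simp
  have "card (Pow (f ` X)) \<le> 2 ^ k"
    using card_inj_on_le[OF inj sub fin] X by (simp add: pieces_le_def)
  then have "card (f ` X) \<le> k" using f by (simp add: card_Pow)
  then show ?thesis using f by simp
qed

section \<open>Removing points from open sets and from convex sets of reals\<close>

lemma pieces_le_remove_point:
  fixes p :: "'a::euclidean_space"
  assumes "open X" "2 \<le> DIM('a)" "pieces_le X k"
  shows "pieces_le (X - {p}) k"
proof (cases "p \<in> X")
  case False then show ?thesis using assms by simp
next
  case True
  then obtain e where e: "e > 0" "ball p e \<subseteq> X" using assms(1) open_contains_ball by blast
  have con: "connected (ball p e - {p})"
    using assms(2) by (intro connected_punctured_ball)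
  have op: "open (X - {p})" using assms(1) by auto
  have opb: "open (insert p A)" if "open A" "ball p e - {p} \<subseteq> A" for A
  proof -
    have "insert p A = A \<union> ball p e" using that e by auto
    then show ?thesis using that by auto
  qed
  have c: "\<exists>B\<in>clopens X. B - {p} = A" if A: "A \<in> clopens (X - {p})" for A
  proof -
    have o: "open A" "open (X - {p} - A)" "A \<subseteq> X - {p}" using A op by (auto simp: clopens_open_iff)
    have "ball p e - {p} \<subseteq> A \<or> (ball p e - {p}) \<inter> A = {}"
      using clopens_connected[OF A con] e by auto
    then show ?thesis
    proof
      assume a: "ball p e - {p} \<subseteq> A"
      have "X - insert p A = X - {p} - A" by auto
      then have "insert p A \<in> clopens X" using o opb[OF o(1) a] assms(1) True
        by (auto simp: clopens_open_iff)
      then show ?thesis using o by (intro bexI[of _ "insert p A"]) auto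
    next
      assume a: "(ball p e - {p}) \<inter> A = {}"
      then have "ball p e - {p} \<subseteq> X - {p} - A" using e by auto
      then have "open (insert p (X - {p} - A))" using opb o by blast
      moreover have "insert p (X - {p} - A) = X - A" using o True by auto
      ultimately have "A \<in> clopens X" using o assms(1)
        by (auto simp: clopens_open_iff)
      then show ?thesis using o by (intro bexI[of _ A]) auto
    qed
  qed
  then obtain F where F: "\<And>A. A \<in> clopens (X - {p}) \<Longrightarrow> F A \<in> clopens X \<and> F A - {p} = A" by metis
  then have "inj_on F (clopens (X - {p}))" by (intro inj_onI) metis
  then show ?thesis using pieces_le_inj F assms(3) by (metis image_subsetI)
qed

text \<open>Stated for an arbitrary convex set so that the induction can pass to the parts of
  \<open>C\<close> on the two sides of a removed point.\<close>

lemma pieces_le_real_minus_finite: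
  fixes C :: "real set"
  assumes "finite F" "convex C"
  shows "pieces_le (C - F) (card F + 1)"
  using assms
proof (induction "card F" arbitrary: F C rule: less_induct)
  case less
  show ?case
  proof (cases "F = {}")
    case True then show ?thesis using less.prems pieces_le_connected convex_connected by auto
  next
    case False
    then obtain p where p: "p \<in> F" by auto
    let ?L = "{x\<in>F. x < p}" and ?R = "{x\<in>F. x > p}"
    have fin: "finite ?L" "finite ?R" using less.prems by auto
    have cF: "card F = card ?L + card ?R + 1"
    proof -
      have "F = insert p (?L \<union> ?R)" using p by auto
      then have "card F = card (insert p (?L \<union> ?R))" by metis
      also have "\<dots> = card ?L + card ?R + 1" using fin by (subst card_insert_disjoint) (auto intro: card_Un_disjoint)
      finally show ?thesis .
    qed
    have "pieces_le (C \<inter> {..<p} - ?L) (card ?L + 1)"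
      by (rule less.hyps) (use cF fin less.prems in \<open>auto intro: convex_Int\<close>)
    moreover have "pieces_le (C \<inter> {p<..} - ?R) (card ?R + 1)"
      by (rule less.hyps) (use cF fin less.prems in \<open>auto intro: convex_Int\<close>)
    ultimately have "pieces_le ((C \<inter> {..<p} - ?L) \<union> (C \<inter> {p<..} - ?R)) ((card ?L + 1) + (card ?R + 1))"
      by (rule pieces_le_Un)
    moreover have "(C \<inter> {..<p} - ?L) \<union> (C \<inter> {p<..} - ?R) = C - F"
    proof -
      have "x \<noteq> p \<longleftrightarrow> x < p \<or> x > p" for x by auto
      then show ?thesis using p by blast
    qed
    ultimately show ?thesis using cF by simp
  qed
qed

section \<open>Cutting along a sphere\<close>

lemma sphere_collar:
  fixes c :: "'a::euclidean_space"
  assumes "open U" "z \<in> U" "r > 0" "z \<in> sphere c r"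
  obtains d where "0 < d" "d < 1"
    "\<And>y. y \<in> sphere c r \<Longrightarrow> dist y z < d \<Longrightarrow> y \<in> U"
    "\<And>y s. y \<in> sphere c r \<Longrightarrow> dist y z < d \<Longrightarrow> s \<noteq> 0 \<Longrightarrow> \<bar>s\<bar> < d \<Longrightarrow>
        y + s *\<^sub>R (y - c) \<in> U - sphere c r"
proof -
  obtain e where e: "e > 0" "ball z e \<subseteq> U" using assms open_contains_ball by blast
  \<comment> \<open>A shift of less than \<open>d\<close> along the sphere and of relative size less
    than \<open>d\<close> along the radius has length below \<open>d + d * r\<close>, hence below
    \<open>e\<close>; \<open>d < 1\<close> keeps the radial factor \<open>1 + s\<close>
    positive.\<close>
  define d where "d = min (1/2) (e / (1 + r))"
  have d: "0 < d" "d < 1" "d \<le> e / (1 + r)" using e assms by (auto simp: d_def)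
  then have d': "d * (1 + r) \<le> e" using assms by (simp add: field_simps)
  show ?thesis
  proof
    show "0 < d" "d < 1" using d by auto
    fix y assume y: "y \<in> sphere c r" "dist y z < d"
    have "d * 1 \<le> d * (1 + r)" using d assms by (intro mult_left_mono) auto
    then show "y \<in> U" using y d' e by (auto simp: dist_commute)
    fix s :: real assume s: "s \<noteq> 0" "\<bar>s\<bar> < d"
    have ny: "norm (y - c) = r" using y by (simp add: dist_norm norm_minus_commute)
    have "dist (y + s *\<^sub>R (y - c)) z \<le> dist y z + \<bar>s\<bar> * r"
    proof -
      have "y + s *\<^sub>R (y - c) - z = (y - z) + s *\<^sub>R (y - c)" by simp
      then have "norm (y + s *\<^sub>R (y - c) - z) \<le> norm (y - z) + norm (s *\<^sub>R (y - c))"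
        by (metis norm_triangle_ineq)
      then show ?thesis unfolding dist_norm using ny by simp
    qed
    also have "\<dots> < d + d * r"
      using y(2) mult_strict_right_mono[OF s(2) assms(3)] by linarith
    also have "\<dots> \<le> e" using d' by (simp add: algebra_simps)
    finally have 1: "y + s *\<^sub>R (y - c) \<in> U" using e by (auto simp: dist_commute)
    have "y + s *\<^sub>R (y - c) - c = (1 + s) *\<^sub>R (y - c)" by (simp add: algebra_simps)
    then have "norm (y + s *\<^sub>R (y - c) - c) = (1 + s) * r" using ny s d by simp
    moreover have "(1 + s) * r \<noteq> r" using s assms by (simp add: algebra_simps)
    ultimately have "y + s *\<^sub>R (y - c) \<notin> sphere c r" by (simp add: dist_norm norm_minus_commute)
    then show "y + s *\<^sub>R (y - c) \<in> U - sphere c r" using 1 by auto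
  qed
qed

text \<open>The points of the sphere near which \<open>A\<close> occupies the outer (\<open>e = 1\<close>) or the inner
  (\<open>e = -1\<close>) side.\<close>

definition sphere_germ :: "'a::euclidean_space set \<Rightarrow> 'a \<Rightarrow> real \<Rightarrow> real \<Rightarrow> 'a set \<Rightarrow> 'a set" where
  "sphere_germ U c r e A =
     {z \<in> U \<inter> sphere c r. \<forall>\<^sub>F t in at_right 0. z + (e * t) *\<^sub>R (z - c) \<in> A}"

text \<open>A short radial segment starting at the sphere is connected and avoids the sphere, so
  each clopen set contains it or misses it. The limit in \<open>sphere_germ\<close> can therefore be
  tested at any single offset \<open>t\<close>, and one \<open>d\<close> works for all sets, both
  sides and all nearby points.\<close>

lemma sphere_germ_collar:
  fixes c :: "'a::euclidean_space"
  assumes "open U" "z \<in> U" "r > 0" "z \<in> sphere c r"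
  obtains d where "0 < d"
    "\<And>y. y \<in> sphere c r \<Longrightarrow> dist y z < d \<Longrightarrow> y \<in> U"
    "\<And>A e y t. A \<in> clopens (U - sphere c r) \<Longrightarrow> e = 1 \<or> e = -1 \<Longrightarrow>
        y \<in> sphere c r \<Longrightarrow> dist y z < d \<Longrightarrow> 0 < t \<Longrightarrow> t < d \<Longrightarrow>
        y \<in> sphere_germ U c r e A \<longleftrightarrow> y + (e * t) *\<^sub>R (y - c) \<in> A"
proof -
  obtain d where d: "0 < d" "d < 1" "\<And>y. y \<in> sphere c r \<Longrightarrow> dist y z < d \<Longrightarrow> y \<in> U"
    and ds: "\<And>y s. y \<in> sphere c r \<Longrightarrow> dist y z < d \<Longrightarrow> s \<noteq> 0 \<Longrightarrow> \<bar>s\<bar> < d \<Longrightarrow>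
        y + s *\<^sub>R (y - c) \<in> U - sphere c r"
    using sphere_collar[OF assms] by blast
  show ?thesis
  proof (rule that[of d])
    show "0 < d" "\<And>y. y \<in> sphere c r \<Longrightarrow> dist y z < d \<Longrightarrow> y \<in> U" using d by auto
    fix A and e :: real and y and t :: real
    assume A: "A \<in> clopens (U - sphere c r)" and e: "e = 1 \<or> e = -1"
      and y: "y \<in> sphere c r" "dist y z < d" and t: "0 < t" "t < d"
    let ?S = "(\<lambda>t. y + (e * t) *\<^sub>R (y - c)) ` {0<..<d}"
    have "connected ?S" by (intro connected_continuous_image continuous_intros) auto
    moreover have sub: "?S \<subseteq> U - sphere c r"
    proof (rule image_subsetI)
      fix s assume "s \<in> {0<..<d}"
      then show "y + (e * s) *\<^sub>R (y - c) \<in> U - sphere c r"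
        using e by (intro ds y) auto
    qed
    ultimately have dich: "?S \<subseteq> A \<or> ?S \<inter> A = {}" using clopens_connected[OF A] by blast
    have tS: "y + (e * t) *\<^sub>R (y - c) \<in> ?S" using t by auto
    have ev: "\<forall>\<^sub>F t in at_right 0. t \<in> {0<..<d}"
      using d(1) by (rule eventually_at_right_real)
    have yU: "y \<in> U" using d y by auto
    show "y \<in> sphere_germ U c r e A \<longleftrightarrow> y + (e * t) *\<^sub>R (y - c) \<in> A"
    proof
      assume "y \<in> sphere_germ U c r e A"
      then have "\<forall>\<^sub>F t in at_right 0. y + (e * t) *\<^sub>R (y - c) \<in> A" by (simp add: sphere_germ_def)
      with ev have "\<forall>\<^sub>F t in at_right 0. y + (e * t) *\<^sub>R (y - c) \<in> A \<and> t \<in> {0<..<d}"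
        by eventually_elim auto
      then obtain t' where "y + (e * t') *\<^sub>R (y - c) \<in> A" "t' \<in> {0<..<d}"
        using eventually_happens'[OF trivial_limit_at_right_real] by blast
      then have "?S \<inter> A \<noteq> {}" by blast
      then show "y + (e * t) *\<^sub>R (y - c) \<in> A" using dich tS by auto
    next
      assume "y + (e * t) *\<^sub>R (y - c) \<in> A"
      then have S: "?S \<subseteq> A" using dich tS by auto
      have "\<forall>\<^sub>F t in at_right 0. y + (e * t) *\<^sub>R (y - c) \<in> A"
        using ev by (rule eventually_mono) (use S in blast)
      then show "y \<in> sphere_germ U c r e A" using y yU by (simp add: sphere_germ_def)
    qed
  qed
qed

lemma sphere_germ_at:
  fixes c :: "'a::euclidean_space"
  assumes "open U" "z \<in> U" "r > 0" "z \<in> sphere c r" "e = 1 \<or> e = -1"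
  obtains d where "0 < d"
    "\<And>A t. A \<in> clopens (U - sphere c r) \<Longrightarrow> 0 < t \<Longrightarrow> t < d \<Longrightarrow>
        z \<in> sphere_germ U c r e A \<longleftrightarrow> z + (e * t) *\<^sub>R (z - c) \<in> A"
proof -
  obtain d where d: "0 < d" and dA: "\<And>A e y t. A \<in> clopens (U - sphere c r) \<Longrightarrow> e = 1 \<or> e = -1 \<Longrightarrow>
        y \<in> sphere c r \<Longrightarrow> dist y z < d \<Longrightarrow> 0 < t \<Longrightarrow> t < d \<Longrightarrow>
        y \<in> sphere_germ U c r e A \<longleftrightarrow> y + (e * t) *\<^sub>R (y - c) \<in> A"
    by (rule sphere_germ_collar[OF assms(1-4)]) blast
  show ?thesis
    by (rule that[OF d dA]) (use assms(4,5) d in auto)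
qed

lemma sphere_germ_clopen:
  fixes c :: "'a::euclidean_space"
  assumes U: "open U" "r > 0" and e: "e = 1 \<or> e = -1" and A: "A \<in> clopens (U - sphere c r)"
  shows "openin (top_of_set (U \<inter> sphere c r)) (sphere_germ U c r e A)"
    and "sphere_germ U c r e (U - sphere c r - A) = U \<inter> sphere c r - sphere_germ U c r e A"
proof -
  have opU: "open (U - sphere c r)" using U by (intro open_Diff) auto
  have opA: "open A" using A opU by (simp add: clopens_open_iff)
  show "openin (top_of_set (U \<inter> sphere c r)) (sphere_germ U c r e A)"
  proof (subst openin_subopen, intro ballI)
    fix z assume z: "z \<in> sphere_germ U c r e A"
    then have zz: "z \<in> U" "z \<in> sphere c r" by (auto simp: sphere_germ_def)
    obtain d where d: "0 < d" "\<And>y t. y \<in> sphere c r \<Longrightarrow> dist y z < d \<Longrightarrow> 0 < t \<Longrightarrow> t < d \<Longrightarrow>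
        y \<in> sphere_germ U c r e A \<longleftrightarrow> y + (e * t) *\<^sub>R (y - c) \<in> A"
      using sphere_germ_collar[OF U(1) zz(1) U(2) zz(2)] A e by metis
    \<comment> \<open>At the fixed offset \<open>d/2\<close> the germ condition becomes the preimage
      of the open set \<open>A\<close> under a continuous map.\<close>
    let ?f = "\<lambda>y. y + (e * (d/2)) *\<^sub>R (y - c)"
    have "open (?f -` A)" using opA by (intro open_vimage continuous_intros)
    then have "open (?f -` A \<inter> ball z d)" by auto
    moreover have "z \<in> ?f -` A \<inter> ball z d" using d(2)[of z "d/2"] z zz d(1) by auto
    moreover have "U \<inter> sphere c r \<inter> (?f -` A \<inter> ball z d) \<subseteq> sphere_germ U c r e A"
      using d(2)[of _ "d/2"] d(1) by (auto simp: dist_commute)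
    ultimately show "\<exists>T. openin (top_of_set (U \<inter> sphere c r)) T \<and> z \<in> T \<and> T \<subseteq> sphere_germ U c r e A"
      using zz openin_open_Int[of "?f -` A \<inter> ball z d"] by blast
  qed
  show "sphere_germ U c r e (U - sphere c r - A) = U \<inter> sphere c r - sphere_germ U c r e A"
  proof (rule set_eqI)
    fix z
    show "z \<in> sphere_germ U c r e (U - sphere c r - A) \<longleftrightarrow> z \<in> U \<inter> sphere c r - sphere_germ U c r e A"
    proof (cases "z \<in> U \<inter> sphere c r")
      case True
      then have zz: "z \<in> U" "z \<in> sphere c r" by auto
      obtain d where d: "0 < d" "\<And>A t. A \<in> clopens (U - sphere c r) \<Longrightarrow> 0 < t \<Longrightarrow> t < d \<Longrightarrow>
        z \<in> sphere_germ U c r e A \<longleftrightarrow> z + (e * t) *\<^sub>R (z - c) \<in> A"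
        by (rule sphere_germ_at[OF U(1) zz(1) U(2) zz(2) e]) blast
      \<comment> \<open>Testing the whole complement shows that the point at offset
        \<open>d/2\<close> lies in \<open>U\<close> and off the sphere, hence in exactly one of
        \<open>A\<close> and its complement.\<close>
      have "U - sphere c r \<in> clopens (U - sphere c r)" by (auto simp: clopens_iff)
      moreover have "z \<in> sphere_germ U c r e (U - sphere c r)"
      proof -
        obtain d where "0 < d" "d < 1" "\<And>s. s \<noteq> 0 \<Longrightarrow> \<bar>s\<bar> < d \<Longrightarrow> z + s *\<^sub>R (z - c) \<in> U - sphere c r"
          using sphere_collar[OF U(1) zz(1) U(2) zz(2)] zz by (metis dist_self)
        have "z + (e * t) *\<^sub>R (z - c) \<in> U - sphere c r" if "t \<in> {0<..<d}" for t
          using that e by (intro \<open>\<And>s. s \<noteq> 0 \<Longrightarrow> \<bar>s\<bar> < d \<Longrightarrow> z + s *\<^sub>R (z - c) \<in> U - sphere c r\<close>) auto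
        then show ?thesis using zz eventually_at_right_real[OF \<open>0 < d\<close>]
          by (auto simp: sphere_germ_def elim!: eventually_mono)
      qed
      ultimately have "z + (e * (d/2)) *\<^sub>R (z - c) \<in> U - sphere c r"
        using d(2)[of "U - sphere c r" "d/2"] d(1) by auto
      then show ?thesis using True d(2)[OF A, of "d/2"] d(2)[OF clopens_Compl[OF A], of "d/2"] d(1) by auto
    next
      case False then show ?thesis by (auto simp: sphere_germ_def)
    qed
  qed
qed

lemma sphere_germ_in_clopens:
  fixes c :: "'a::euclidean_space"
  assumes "open U" "r > 0" "e = 1 \<or> e = -1" "A \<in> clopens (U - sphere c r)"
  shows "sphere_germ U c r e A \<in> clopens (U \<inter> sphere c r)"
proof -
  have "sphere_germ U c r e A \<subseteq> U \<inter> sphere c r" by (auto simp: sphere_germ_def)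
  then show ?thesis
    using sphere_germ_clopen(1)[OF assms] sphere_germ_clopen(2)[OF assms]
      sphere_germ_clopen(1)[OF assms(1-3) clopens_Compl[OF assms(4)]]
    unfolding clopens_iff by metis
qed

lemma sphere_germ_sym_diff:
  fixes c :: "'a::euclidean_space"
  assumes U: "open U" "r > 0" and e: "e = 1 \<or> e = -1"
    and A: "A \<in> clopens (U - sphere c r)" and B: "B \<in> clopens (U - sphere c r)"
  shows "sphere_germ U c r e ((A - B) \<union> (B - A)) =
    (sphere_germ U c r e A - sphere_germ U c r e B) \<union> (sphere_germ U c r e B - sphere_germ U c r e A)"
proof (rule set_eqI)
  fix z
  show "z \<in> sphere_germ U c r e ((A - B) \<union> (B - A)) \<longleftrightarrow> z \<in>
    (sphere_germ U c r e A - sphere_germ U c r e B) \<union> (sphere_germ U c r e B - sphere_germ U c r e A)"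
  proof (cases "z \<in> U \<inter> sphere c r")
    case True
    then have zz: "z \<in> U" "z \<in> sphere c r" by auto
    obtain d where d: "0 < d" "\<And>A t. A \<in> clopens (U - sphere c r) \<Longrightarrow> 0 < t \<Longrightarrow> t < d \<Longrightarrow>
      z \<in> sphere_germ U c r e A \<longleftrightarrow> z + (e * t) *\<^sub>R (z - c) \<in> A"
      by (rule sphere_germ_at[OF U(1) zz(1) U(2) zz(2) e]) blast
    show ?thesis
      using d(2)[OF A, of "d/2"] d(2)[OF B, of "d/2"] d(2)[OF clopens_sym_diff[OF A B], of "d/2"] d(1) by auto
  next
    case False then show ?thesis by (auto simp: sphere_germ_def)
  qed
qed

lemma open_glue_germ:
  fixes c :: "'a::euclidean_space"
  assumes U: "open U" "r > 0" and D: "D \<in> clopens (U - sphere c r)"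
    and eq: "sphere_germ U c r 1 D = sphere_germ U c r (-1) D"
  shows "open (D \<union> sphere_germ U c r 1 D)"
proof (subst open_subopen, intro ballI)
  have "open (U - sphere c r)" using U by (intro open_Diff) auto
  then have opD: "open D" using D by (simp add: clopens_open_iff)
  fix z assume "z \<in> D \<union> sphere_germ U c r 1 D"
  then show "\<exists>T. open T \<and> z \<in> T \<and> T \<subseteq> D \<union> sphere_germ U c r 1 D"
  proof
    assume "z \<in> D" then show ?thesis using opD by blast
  next
    assume z: "z \<in> sphere_germ U c r 1 D"
    then have zz: "z \<in> U" "z \<in> sphere c r" by (auto simp: sphere_germ_def)
    obtain d where d: "0 < d"
      and dU: "\<And>y. y \<in> sphere c r \<Longrightarrow> dist y z < d \<Longrightarrow> y \<in> U"
      and dA: "\<And>e y t. e = 1 \<or> e = -1 \<Longrightarrow>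
        y \<in> sphere c r \<Longrightarrow> dist y z < d \<Longrightarrow> 0 < t \<Longrightarrow> t < d \<Longrightarrow>
        y \<in> sphere_germ U c r e D \<longleftrightarrow> y + (e * t) *\<^sub>R (y - c) \<in> D"
      by (rule sphere_germ_collar[OF U(1) zz(1) U(2) zz(2)]) (use D in blast)
    obtain W where W: "open W" "sphere_germ U c r 1 D = U \<inter> sphere c r \<inter> W"
      using sphere_germ_clopen(1)[OF U _ D, of 1] by (auto simp: openin_open)
    \<comment> \<open>Polar coordinates: \<open>p x\<close> is the radial projection to the sphere
      and \<open>s x\<close> the signed relative height, with \<open>x\<close> recovered as
      \<open>p x\<close> moved by \<open>s x\<close> along the radius. The sign of
      \<open>s x\<close> decides which of the two germs applies.\<close>
    define p where "p x = c + (r / norm (x - c)) *\<^sub>R (x - c)" for x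
    define s where "s x = norm (x - c) / r - 1" for x
    have nz: "norm (z - c) = r" using zz by (simp add: dist_norm norm_minus_commute)
    have pz: "p z = z" "s z = 0" using nz U by (auto simp: p_def s_def)
    have cont: "continuous_on (- {c}) p" "continuous_on (- {c}) s"
      unfolding p_def s_def using U by (auto intro!: continuous_intros)
    have op: "open (- {c} \<inter> p -` (W \<inter> ball z d))" "open (- {c} \<inter> s -` {-d<..<d})"
      using W by (auto intro!: continuous_open_preimage[OF cont(1)] continuous_open_preimage[OF cont(2)] simp del: vimage_Int)
    let ?T = "(- {c} \<inter> p -` (W \<inter> ball z d)) \<inter> (- {c} \<inter> s -` {-d<..<d})"
    have "open ?T" using op by (rule open_Int)
    moreover have "z \<in> ?T" using z W pz d nz U by auto
    moreover have "?T \<subseteq> D \<union> sphere_germ U c r 1 D"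
    proof
      fix x assume x: "x \<in> ?T"
      then have xc: "x \<noteq> c" by auto
      then have "norm (p x - c) = r" using U by (simp add: p_def)
      then have pS: "p x \<in> sphere c r" by (simp add: dist_norm norm_minus_commute)
      have pd: "dist (p x) z < d" "p x \<in> W" using x by (auto simp: dist_commute)
      then have pG: "p x \<in> sphere_germ U c r 1 D" "p x \<in> sphere_germ U c r (-1) D"
        using W dU pS eq by auto
      have "p x + s x *\<^sub>R (p x - c) = c + ((1 + s x) * (r / norm (x - c))) *\<^sub>R (x - c)"
        unfolding p_def by (simp add: scaleR_left_distrib distrib_right add_divide_distrib)
      also have "(1 + s x) * (r / norm (x - c)) = 1" using xc U by (simp add: s_def field_simps)
      finally have xe: "p x + s x *\<^sub>R (p x - c) = x" by simp
      have sx: "\<bar>s x\<bar> < d" using x by auto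
      consider "s x = 0" | "s x > 0" | "s x < 0" by linarith
      then show "x \<in> D \<union> sphere_germ U c r 1 D"
      proof cases
        case 1 then show ?thesis using xe pG by simp
      next
        case 2 then show ?thesis using dA[of 1 "p x" "s x"] pS pd pG sx xe by auto
      next
        case 3 then show ?thesis using dA[of "-1" "p x" "- s x"] pS pd pG sx xe by auto
      qed
    qed
    ultimately show ?thesis by blast
  qed
qed

text \<open>A clopen subset of the complement extends across the sphere where its germs on the two sides
  agree, so it is determined, up to a clopen subset of \<open>U\<close>, by the set where they differ.\<close>

lemma pieces_le_remove_sphere:
  fixes c :: "'a::euclidean_space"
  assumes U: "open U" "r > 0" and pU: "pieces_le U j" and pZ: "pieces_le (U \<inter> sphere c r) k"
  shows "pieces_le (U - sphere c r) (j + k)"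
proof (rule pieces_le_add[OF _ _ pU pZ])
  let ?G = "sphere_germ U c r"
  let ?J = "\<lambda>A. (?G 1 A - ?G (-1) A) \<union> (?G (-1) A - ?G 1 A)"
  show "?J A \<in> clopens (U \<inter> sphere c r)" if "A \<in> clopens (U - sphere c r)" for A
    using U that by (intro clopens_sym_diff sphere_germ_in_clopens) auto
  fix A B assume A: "A \<in> clopens (U - sphere c r)" and B: "B \<in> clopens (U - sphere c r)" and J: "?J A = ?J B"
  define D where "D = (A - B) \<union> (B - A)"
  have D: "D \<in> clopens (U - sphere c r)" unfolding D_def using A B by (rule clopens_sym_diff)
  have "?G 1 D = (?G 1 A - ?G 1 B) \<union> (?G 1 B - ?G 1 A)"
       "?G (-1) D = (?G (-1) A - ?G (-1) B) \<union> (?G (-1) B - ?G (-1) A)"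
    unfolding D_def using sphere_germ_sym_diff[OF U _ A B] by blast+
  \<comment> \<open>Germs commute with symmetric difference, so equal jumps of \<open>A\<close> and
    \<open>B\<close> mean that \<open>D\<close> has no jump. The same then holds for the complement
    of \<open>D\<close>, and gluing both makes the extension clopen rather than merely open.\<close>
  then have eq: "?G 1 D = ?G (-1) D" using J by blast
  then have eq': "?G 1 (U - sphere c r - D) = ?G (-1) (U - sphere c r - D)"
    using sphere_germ_clopen(2)[OF U _ D] by simp
  have "open (D \<union> ?G 1 D)" by (rule open_glue_germ[OF U D eq])
  moreover have "open (U - sphere c r - D \<union> ?G 1 (U - sphere c r - D))"
    by (rule open_glue_germ[OF U clopens_Compl[OF D] eq'])
  moreover have "U - sphere c r - D \<union> ?G 1 (U - sphere c r - D) = U - (D \<union> ?G 1 D)"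
    using sphere_germ_clopen(2)[OF U _ D, of 1] clopens_subset[OF D]
    by (auto simp: sphere_germ_def)
  moreover have "D \<union> ?G 1 D \<subseteq> U" using clopens_subset[OF D] by (auto simp: sphere_germ_def)
  ultimately have "D \<union> ?G 1 D \<in> clopens U" using U by (simp add: clopens_open_iff)
  moreover have "(D \<union> ?G 1 D) \<inter> (U - sphere c r) = D"
    using clopens_subset[OF D] by (auto simp: sphere_germ_def)
  ultimately show "\<exists>C\<in>clopens U. C \<inter> (U - sphere c r) = (A - B) \<union> (B - A)"
    unfolding D_def by blast
qed

section \<open>Regions of arrangements of spheres and planes\<close>

text \<open>The coefficients are unrestricted: \<open>A = 0\<close> gives planes, and single points,
  the empty set and the whole space occur as degenerate cases.\<close>

definition quadric :: "real \<Rightarrow> 'a::euclidean_space \<Rightarrow> real \<Rightarrow> 'a set" where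
  "quadric A b C = {x. A * (x \<bullet> x) + b \<bullet> x + C = 0}"

lemma closed_quadric: "closed (quadric A b C)"
  unfolding quadric_def by (intro closed_Collect_eq continuous_intros)

text \<open>Taylor expansion at \<open>q\<close>: the linear coefficient is the gradient and the
  constant term the value of the polynomial there. If both vanish and \<open>A \<noteq> 0\<close>,
  the quadric is the single point \<open>q\<close>.\<close>

lemma quadric_recenter:
  "q + u \<in> quadric A b C \<longleftrightarrow>
     A * (u \<bullet> u) + ((2 * A) *\<^sub>R q + b) \<bullet> u + (A * (q \<bullet> q) + b \<bullet> q + C) = 0"
  by (simp add: quadric_def algebra_simps inner_commute)

text \<open>The recentred equation multiplied by \<open>w \<bullet> w\<close>, which exchanges its
  leading and constant coefficients.\<close>

lemma inversion_in_quadric_iff: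
  assumes "w \<noteq> 0"
  shows "q + (1 / (w \<bullet> w)) *\<^sub>R w \<in> quadric A b C \<longleftrightarrow>
     A + ((2 * A) *\<^sub>R q + b) \<bullet> w + (A * (q \<bullet> q) + b \<bullet> q + C) * (w \<bullet> w) = 0"
proof -
  define K where "K = A * (q \<bullet> q) + b \<bullet> q + C"
  define v where "v = (2 * A) *\<^sub>R q + b"
  have w: "w \<bullet> w \<noteq> 0" using assms by simp
  have "q + (1 / (w \<bullet> w)) *\<^sub>R w \<in> quadric A b C \<longleftrightarrow>
     A * (1 / (w \<bullet> w) * (1 / (w \<bullet> w) * (w \<bullet> w))) + 1 / (w \<bullet> w) * (v \<bullet> w) + K = 0"
    unfolding quadric_recenter K_def[symmetric] v_def[symmetric] by (simp add: ac_simps)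
  also have "\<dots> \<longleftrightarrow> A + v \<bullet> w + K * (w \<bullet> w) = 0" using w by (simp add: field_simps)
  finally show ?thesis unfolding K_def v_def .
qed

lemma quadric_sphere:
  assumes "A \<noteq> 0"
  obtains c r where "quadric A b C = sphere c r"
proof -
  define c where "c = - (1 / (2 * A)) *\<^sub>R b"
  define \<rho> where "\<rho> = c \<bullet> c - C / A"
  \<comment> \<open>Completing the square may leave a negative squared radius; the radius
    \<open>-1\<close> then encodes the empty sphere.\<close>
  define r where "r = (if \<rho> \<ge> 0 then sqrt \<rho> else -1)"
  have b: "b = - (2 * A) *\<^sub>R c" using assms by (simp add: c_def)
  have 1: "x \<in> quadric A b C \<longleftrightarrow> (x - c) \<bullet> (x - c) = \<rho>" for x
  proof -
    have "A * (x \<bullet> x) + b \<bullet> x + C = A * ((x - c) \<bullet> (x - c) - \<rho>)"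
      using assms by (simp add: b \<rho>_def algebra_simps inner_commute)
    then show ?thesis using assms by (simp add: quadric_def)
  qed
  have 2: "(x - c) \<bullet> (x - c) = \<rho> \<longleftrightarrow> dist c x = r" for x
  proof (cases "\<rho> \<ge> 0")
    case True
    have "dist c x = sqrt ((x - c) \<bullet> (x - c))"
      by (metis dist_commute dist_norm norm_eq_sqrt_inner)
    then show ?thesis using True by (simp add: r_def)
  next
    case False
    have "(x - c) \<bullet> (x - c) \<ge> 0" "dist c x \<ge> 0" by simp_all
    then have "(x - c) \<bullet> (x - c) \<noteq> \<rho>" "dist c x \<noteq> -1" using False by linarith+
    then show ?thesis using False by (simp add: r_def)
  qed
  show ?thesis by (rule that[of c r]) (auto simp: 1 2)
qed

lemma pieces_le_remove_quadric:
  fixes b :: "'a::euclidean_space"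
  assumes "open U" "2 \<le> DIM('a)" "A \<noteq> 0" "pieces_le U j" "pieces_le (U \<inter> quadric A b C) k"
  shows "pieces_le (U - quadric A b C) (j + k)"
proof -
  obtain c r where q: "quadric A b C = sphere c r" using quadric_sphere[OF assms(3)] .
  consider "r > 0" | "r = 0" | "r < 0" by linarith
  then show ?thesis
  proof cases
    case 1 then show ?thesis using pieces_le_remove_sphere assms q by metis
  next
    case 2
    then have "pieces_le (U - sphere c r) j"
      using pieces_le_remove_point[OF assms(1,2,4)] by simp
    then show ?thesis unfolding q by (rule pieces_le_mono) simp
  next
    case 3
    then have "U - sphere c r = U" by auto
    then show ?thesis unfolding q using assms(4) pieces_le_mono by fastforce
  qed
qed

text \<open>Inversion centred at a point of a sphere flattens the sphere to a hyperplane.\<close>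

lemma quadric_stereographic:
  fixes b q :: "'a::euclidean_space"
  assumes dim: "DIM('a) = Suc DIM('b::euclidean_space)"
    and A: "A \<noteq> 0" and q: "q \<in> quadric A b C" and nz: "(2 * A) *\<^sub>R q + b \<noteq> 0"
  obtains \<phi> :: "'b::euclidean_space \<Rightarrow> 'a" where "continuous_on UNIV \<phi>" "range \<phi> = quadric A b C - {q}"
    "q \<in> closure (range \<phi>)"
    "\<And>A' b' C'. \<exists>b'' C''. \<forall>y. \<phi> y \<in> quadric A' b' C' \<longleftrightarrow> y \<in> quadric (A' * (q \<bullet> q) + b' \<bullet> q + C') b'' C''"
proof -
  define v where "v = (2 * A) *\<^sub>R q + b"
  have v: "v \<noteq> 0" "v \<bullet> v \<noteq> 0" using nz by (auto simp: v_def)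
  \<comment> \<open>Equality of dimensions yields an isometry \<open>g\<close> of the parameter
    space onto the hyperplane orthogonal to \<open>v\<close>.\<close>
  have "dim (UNIV :: 'b set) = dim {x. v \<bullet> x = 0}"
    using dim dim_hyperplane[OF v(1)] by simp
  then obtain g :: "'b \<Rightarrow> 'a" where g: "linear g" "range g = {x. v \<bullet> x = 0}" "\<And>y. norm (g y) = norm y"
    using isometries_subspaces[of "UNIV :: 'b set" "{x. v \<bullet> x = 0}"] subspace_hyperplane[of v]
    by (metis UNIV_I subspace_UNIV)
  have contg: "continuous_on UNIV g" using g(1) by (simp add: linear_continuous_on linear_linear)
  have vg: "v \<bullet> g y = 0" for y using g(2) by auto
  have gg: "g y \<bullet> g y = y \<bullet> y" for y using g(3)[of y] by (simp add: norm_eq_sqrt_inner)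
  \<comment> \<open>The value at \<open>q\<close> is zero, so inversion turns the quadric into the
    hyperplane \<open>v \<bullet> w = - A\<close>, and \<open>w0\<close> is its point nearest to the
    origin. Since \<open>w0\<close> is orthogonal to the range of \<open>g\<close>, the square of
    \<open>w y\<close> has no term linear in \<open>y\<close>.\<close>
  define w0 where "w0 = - (A / (v \<bullet> v)) *\<^sub>R v"
  have vw0: "v \<bullet> w0 = - A" using v by (simp add: w0_def)
  have w0g: "w0 \<bullet> g y = 0" for y by (simp add: w0_def vg)
  define w where "w y = w0 + g y" for y
  have vw: "v \<bullet> w y = - A" for y by (simp add: w_def inner_add_right vw0 vg)
  then have wnz: "w y \<noteq> 0" for y using A by (metis inner_zero_right neg_equal_0_iff_equal)
  have ww: "w y \<bullet> w y = w0 \<bullet> w0 + y \<bullet> y" for y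
    by (simp add: w_def inner_add_left inner_add_right gg w0g inner_commute[of "g y" w0])
  define \<phi> where "\<phi> y = q + (1 / (w y \<bullet> w y)) *\<^sub>R w y" for y
  have contw: "continuous_on UNIV w" unfolding w_def by (intro continuous_intros contg)
  show ?thesis
  proof (rule that[of \<phi>])
    show "continuous_on UNIV \<phi>" unfolding \<phi>_def using wnz
      by (intro continuous_intros contw) auto
    have Kq: "A * (q \<bullet> q) + b \<bullet> q + C = 0" using q by (simp add: quadric_def)
    have in_iff: "q + (1 / (u \<bullet> u)) *\<^sub>R u \<in> quadric A b C \<longleftrightarrow> A + v \<bullet> u = 0" if "u \<noteq> 0" for u
      unfolding inversion_in_quadric_iff[OF that] Kq v_def[symmetric] by simp
    show "range \<phi> = quadric A b C - {q}"
    proof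
      show "range \<phi> \<subseteq> quadric A b C - {q}"
        using in_iff[OF wnz] vw wnz by (auto simp: \<phi>_def)
      show "quadric A b C - {q} \<subseteq> range \<phi>"
      proof
        fix x assume x: "x \<in> quadric A b C - {q}"
        define u where "u = (1 / ((x - q) \<bullet> (x - q))) *\<^sub>R (x - q)"
        have u0: "u \<noteq> 0" using x by (simp add: u_def)
        have uu: "u \<bullet> u = 1 / ((x - q) \<bullet> (x - q))" using x by (simp add: u_def)
        have xu: "q + (1 / (u \<bullet> u)) *\<^sub>R u = x" unfolding uu using x by (simp add: u_def)
        then have "A + v \<bullet> u = 0" using in_iff[OF u0] x by simp
        then have "v \<bullet> (u - w0) = 0" using vw0 by (simp add: inner_diff_right)
        then obtain y where "u - w0 = g y" using g(2) by blast
        then have "w y = u" by (simp add: w_def algebra_simps)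
        then show "x \<in> range \<phi>" using xu by (auto simp: \<phi>_def intro!: image_eqI[of _ _ y])
      qed
    qed
    show "q \<in> closure (range \<phi>)"
    proof (subst closure_approachable, intro allI impI)
      fix e :: real assume e: "e > 0"
      \<comment> \<open>Inversion sends far points close to its centre: the distance of the image
        from \<open>q\<close> is \<open>1 / norm (w B)\<close>, and \<open>w B\<close> is at least
        as long as \<open>B\<close>.\<close>
      obtain B :: 'b where B: "norm B = 1 / e + 1"
        using vector_choose_size[of "1 / e + 1"] e by auto
      have "norm (\<phi> B - q) = 1 / norm (w B)" using wnz[of B]
        by (simp add: \<phi>_def power2_norm_eq_inner[symmetric] power2_eq_square)
      moreover have "norm (w B) > 1 / e"
      proof -
        have "(norm B)^2 \<le> (norm (w B))^2" by (simp add: power2_norm_eq_inner ww)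
        then have "norm B \<le> norm (w B)" by (rule power2_le_imp_le) simp
        then show ?thesis using B by simp
      qed
      moreover have "1 / e > 0" using e by simp
      moreover have "norm (w B) > 0" using wnz[of B] by simp
      ultimately have "norm (\<phi> B - q) < e" using e
        by (metis divide_less_eq mult.commute)
      then show "\<exists>y\<in>range \<phi>. dist y q < e" by (auto simp: dist_norm)
    qed
    fix A' C' :: real and b' :: 'a
    define K where "K = A' * (q \<bullet> q) + b' \<bullet> q + C'"
    define v' where "v' = (2 * A') *\<^sub>R q + b'"
    have "\<phi> y \<in> quadric A' b' C' \<longleftrightarrow> y \<in> quadric K (adjoint g v') (A' + v' \<bullet> w0 + K * (w0 \<bullet> w0))" for y
    proof -
      have "v' \<bullet> g y = adjoint g v' \<bullet> y" using adjoint_works[OF g(1)] by (metis inner_commute)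
      then have "y \<in> quadric K (adjoint g v') (A' + v' \<bullet> w0 + K * (w0 \<bullet> w0)) \<longleftrightarrow>
          A' + v' \<bullet> w y + K * (w0 \<bullet> w0 + y \<bullet> y) = 0"
        by (simp add: quadric_def w_def algebra_simps)
      moreover have "\<phi> y \<in> quadric A' b' C' \<longleftrightarrow> A' + v' \<bullet> w y + K * (w y \<bullet> w y) = 0"
        unfolding \<phi>_def inversion_in_quadric_iff[OF wnz] K_def v'_def ..
      ultimately show ?thesis unfolding ww by blast
    qed
    then show "\<exists>b'' C''. \<forall>y. \<phi> y \<in> quadric A' b' C' \<longleftrightarrow> y \<in> quadric (A' * (q \<bullet> q) + b' \<bullet> q + C') b'' C''"
      unfolding K_def by blast
  qed
qed

text \<open>A circle meeting one of \<open>m\<close> other circles is cut into at most \<open>2 * m\<close> arcs, and it is a single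
  piece if it meets none of them.\<close>

primrec plane_regions :: "nat \<Rightarrow> nat" where
  "plane_regions 0 = 1"
| "plane_regions (Suc m) = plane_regions m + max 1 (2 * m)"

primrec space_regions :: "nat \<Rightarrow> nat" where
  "space_regions 0 = 1"
| "space_regions (Suc m) = space_regions m + plane_regions m"

lemma plane_regions_pos: "plane_regions m \<ge> 1"
  by (induction m) auto

text \<open>This is the classical \<open>m^2 - m + 2\<close> for circles, written at
  \<open>Suc m\<close>. The shift matters: for the empty arrangement the formula would give 2
  instead of 1, just as the cubic for spheres gives 0 there.\<close>

lemma real_plane_regions: "real (plane_regions (Suc m)) = real m ^ 2 + real m + 2"
  by (induction m) (auto simp: max_def algebra_simps power2_eq_square)

lemma real_space_regions:
  "real (space_regions (Suc m)) = (real (Suc m) ^ 3 - 3 * real (Suc m) ^ 2 + 8 * real (Suc m)) / 3"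
proof (induction m)
  case 0 then show ?case by simp
next
  case (Suc m)
  have "real (space_regions (Suc (Suc m))) = real (space_regions (Suc m)) + real (plane_regions (Suc m))"
    by simp
  also have "\<dots> = (real (Suc m) ^ 3 - 3 * real (Suc m) ^ 2 + 8 * real (Suc m)) / 3 + (real m ^ 2 + real m + 2)"
    by (simp only: Suc real_plane_regions)
  also have "\<dots> = (real (Suc (Suc m)) ^ 3 - 3 * real (Suc (Suc m)) ^ 2 + 8 * real (Suc (Suc m))) / 3"
    by (simp add: field_simps power2_eq_square power3_eq_cube)
  finally show ?case .
qed

definition off_quadrics :: "'i set \<Rightarrow> ('i \<Rightarrow> real) \<Rightarrow> ('i \<Rightarrow> 'a::euclidean_space) \<Rightarrow> ('i \<Rightarrow> real) \<Rightarrow> 'a set" where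
  "off_quadrics I A b C = {x. \<forall>i\<in>I. x \<notin> quadric (A i) (b i) (C i)}"

lemma open_off_quadrics: "finite I \<Longrightarrow> open (off_quadrics I A b C)"
proof -
  assume "finite I"
  moreover have "off_quadrics I A b C = - (\<Union>i\<in>I. quadric (A i) (b i) (C i))"
    by (auto simp: off_quadrics_def)
  moreover have "closed (\<Union>i\<in>I. quadric (A i) (b i) (C i))"
    using calculation(1) closed_quadric by (intro closed_UN) auto
  ultimately show ?thesis by (metis open_Compl)
qed

lemma off_quadrics_insert:
  "off_quadrics (insert i I) A b C = off_quadrics I A b C - quadric (A i) (b i) (C i)"
  by (auto simp: off_quadrics_def)

section \<open>Counting pieces on circles, in the plane, on spheres and in space\<close>

lemma real_quadric_finite:
  fixes b :: real
  assumes "quadric A b C \<noteq> UNIV"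
  shows "finite (quadric A b C)" "card (quadric A b C) \<le> (if A = 0 then 1 else 2)"
proof -
  have eq: "quadric A b C = {x. poly [:C, b, A:] x = 0}"
    by (auto simp: quadric_def algebra_simps)
  have nz: "[:C, b, A:] \<noteq> 0"
  proof
    assume "[:C, b, A:] = 0"
    then have "A = 0" "b = 0" "C = 0" by simp_all
    then show False using assms by (simp add: quadric_def)
  qed
  show "finite (quadric A b C)" unfolding eq by (rule poly_roots_finite[OF nz])
  have "card (quadric A b C) \<le> degree [:C, b, A:]" unfolding eq by (rule card_poly_roots_bound[OF nz])
  also have "\<dots> \<le> (if A = 0 then 1 else 2)" by simp
  finally show "card (quadric A b C) \<le> (if A = 0 then 1 else 2)" .
qed

text \<open>The projection centre \<open>q\<close> is taken where the circle meets some other circle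
  \<open>j\<close>. Nothing of \<open>?X\<close> is lost at \<open>q\<close>, and the trace of
  \<open>j\<close> becomes the root set of an equation of degree at most one. At most
  \<open>2 * card I - 1\<close> parameters are removed from the line, leaving at most
  \<open>2 * card I\<close> intervals.\<close>

lemma pieces_le_off_quadrics_line:
  fixes b :: "'i \<Rightarrow> 'a::euclidean_space" and b0 :: 'a
  assumes dim: "DIM('a) = 2" and I: "finite I" and A0: "A0 \<noteq> 0"
  shows "pieces_le (off_quadrics I A b C \<inter> quadric A0 b0 C0) (max 1 (2 * card I))"
    (is "pieces_le ?X _")
proof -
  obtain c r where sph: "quadric A0 b0 C0 = sphere c r" using quadric_sphere[OF A0] .
  have conn: "connected (quadric A0 b0 C0)"
    unfolding sph using connected_sphere[of c r] dim by simp
  show ?thesis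
  proof (cases "\<exists>i\<in>I. quadric A0 b0 C0 \<inter> quadric (A i) (b i) (C i) \<noteq> {}")
    case False
    then have "?X = quadric A0 b0 C0" by (auto simp: off_quadrics_def)
    then show ?thesis using pieces_le_connected[OF conn] by (metis pieces_le_mono max.cobounded1)
  next
    case True
    then obtain j q where j: "j \<in> I" and q: "q \<in> quadric A0 b0 C0" "q \<in> quadric (A j) (b j) (C j)" by auto
    show ?thesis
    proof (cases "(2 * A0) *\<^sub>R q + b0 = 0 \<or> ?X = {}")
      case True
      \<comment> \<open>With vanishing gradient the circle shrinks to \<open>q\<close>, which lies
        on quadric \<open>j\<close> and is therefore excluded.\<close>
      moreover have "?X = {}" if z: "(2 * A0) *\<^sub>R q + b0 = 0"
      proof -
        have Kq: "A0 * (q \<bullet> q) + b0 \<bullet> q + C0 = 0" using q by (simp add: quadric_def)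
        have "x = q" if "x \<in> quadric A0 b0 C0" for x
        proof -
          have "q + (x - q) \<in> quadric A0 b0 C0" using that by simp
          then show ?thesis using A0 unfolding quadric_recenter z Kq by simp
        qed
        then show ?thesis using q j unfolding off_quadrics_def by blast
      qed
      ultimately have "?X = {}" by blast
      then show ?thesis by (metis pieces_le_empty)
    next
      case False
      have "DIM('a) = Suc DIM(real)" using dim by simp
      then obtain \<phi> :: "real \<Rightarrow> 'a" where \<phi>: "continuous_on UNIV \<phi>" "range \<phi> = quadric A0 b0 C0 - {q}"
        and pull: "\<And>A' b' C'. \<exists>b'' C''. \<forall>y. \<phi> y \<in> quadric A' b' C' \<longleftrightarrow> y \<in> quadric (A' * (q \<bullet> q) + b' \<bullet> q + C') b'' C''"
        by (rule quadric_stereographic[OF _ A0 q(1)]) (use False in blast)+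
      define L where "L i = A i * (q \<bullet> q) + b i \<bullet> q + C i" for i
      have "\<forall>i. \<exists>b'' C''. \<forall>y. \<phi> y \<in> quadric (A i) (b i) (C i) \<longleftrightarrow> y \<in> quadric (L i) b'' C''"
        unfolding L_def using pull by blast
      then obtain b'' C'' where bC: "\<And>i y. \<phi> y \<in> quadric (A i) (b i) (C i) \<longleftrightarrow> y \<in> quadric (L i) (b'' i) (C'' i)"
        by metis
      define F where "F = (\<Union>i\<in>I. quadric (L i) (b'' i) (C'' i))"
      have im: "\<phi> ` (UNIV - F) = ?X"
      proof
        show "\<phi> ` (UNIV - F) \<subseteq> ?X" using bC \<phi>(2) by (auto simp: F_def off_quadrics_def)
        show "?X \<subseteq> \<phi> ` (UNIV - F)"
        proof
          fix x assume x: "x \<in> ?X"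
          then have "x \<noteq> q" using q j by (auto simp: off_quadrics_def)
          then have "x \<in> range \<phi>" using x unfolding \<phi>(2) by auto
          then obtain y where y: "x = \<phi> y" by blast
          have "y \<notin> F" using x bC by (auto simp: y F_def off_quadrics_def)
          then show "x \<in> \<phi> ` (UNIV - F)" using y by blast
        qed
      qed
      \<comment> \<open>A trace filling the whole line would leave \<open>?X\<close> empty, a case
        already settled.\<close>
      have nU: "quadric (L i) (b'' i) (C'' i) \<noteq> UNIV" if "i \<in> I" for i
        using False im that by (auto simp: F_def)
      have fin: "finite F" unfolding F_def using I real_quadric_finite(1)[OF nU] by auto
      have Lj: "L j = 0" using q(2) by (simp add: L_def quadric_def)
      have "card F \<le> (\<Sum>i\<in>I. card (quadric (L i) (b'' i) (C'' i)))"
        unfolding F_def using I by (rule card_UN_le)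
      also have "\<dots> \<le> (\<Sum>i\<in>I. if i = j then 1 else 2)"
      proof (rule sum_mono)
        fix i assume "i \<in> I"
        then show "card (quadric (L i) (b'' i) (C'' i)) \<le> (if i = j then 1 else 2)"
          using real_quadric_finite(2)[OF nU, of i] Lj by (auto split: if_splits)
      qed
      also have "\<dots> = 1 + 2 * (card I - 1)" using I j by (subst sum.remove[OF I j]) simp
      also have "\<dots> \<le> 2 * card I - 1" using I j by (cases "card I") auto
      finally have "card F + 1 \<le> max 1 (2 * card I)" by simp
      then have "pieces_le (UNIV - F) (max 1 (2 * card I))"
        using pieces_le_real_minus_finite[OF fin convex_UNIV] pieces_le_mono by blast
      then show ?thesis
        using im \<phi>(1) closure_subset[of ?X]
        by (intro pieces_le_dense_image[of "UNIV - F" \<phi> ?X]) (auto intro: continuous_on_subset)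
    qed
  qed
qed

lemma pieces_le_off_quadrics_plane:
  fixes b :: "'i \<Rightarrow> 'a::euclidean_space"
  assumes dim: "DIM('a) = 2" and I: "finite I" "\<forall>i\<in>I. A i \<noteq> 0"
  shows "pieces_le (off_quadrics I A b C) (plane_regions (card I))"
  using I
proof (induction I rule: finite_induct)
  case empty
  then show ?case using pieces_le_connected[OF connected_UNIV] by (simp add: off_quadrics_def)
next
  case (insert i I)
  have "pieces_le (off_quadrics I A b C - quadric (A i) (b i) (C i)) (plane_regions (card I) + max 1 (2 * card I))"
  proof (rule pieces_le_remove_quadric)
    show "open (off_quadrics I A b C)" by (rule open_off_quadrics) fact
    show "2 \<le> DIM('a)" "A i \<noteq> 0" using dim insert.prems by auto
    show "pieces_le (off_quadrics I A b C) (plane_regions (card I))" using insert by blast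
    show "pieces_le (off_quadrics I A b C \<inter> quadric (A i) (b i) (C i)) (max 1 (2 * card I))"
      using dim insert.hyps(1) insert.prems by (intro pieces_le_off_quadrics_line) auto
  qed
  then show ?case using insert by (simp add: off_quadrics_insert)
qed

text \<open>In contrast to the circle, the projection centre is taken off all the other quadrics, so
  every trace in the plane keeps a nonzero leading coefficient and the planar count applies. The
  centre is a point of \<open>?X\<close> missed by the projection, and it is recovered as a limit of
  the remaining points.\<close>

lemma pieces_le_off_quadrics_surface:
  fixes b :: "'i \<Rightarrow> real^3" and b0 :: "real^3"
  assumes I: "finite I" and A0: "A0 \<noteq> 0"
  shows "pieces_le (off_quadrics I A b C \<inter> quadric A0 b0 C0) (plane_regions (card I))"
    (is "pieces_le ?X _")
proof (cases "?X = {}")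
  case True then show ?thesis by (metis pieces_le_empty)
next
  case False
  then obtain q where q: "q \<in> off_quadrics I A b C" "q \<in> quadric A0 b0 C0" by auto
  show ?thesis
  proof (cases "(2 * A0) *\<^sub>R q + b0 = 0")
    case True
    have Kq: "A0 * (q \<bullet> q) + b0 \<bullet> q + C0 = 0" using q by (simp add: quadric_def)
    have "x = q" if "x \<in> quadric A0 b0 C0" for x
    proof -
      have "q + (x - q) \<in> quadric A0 b0 C0" using that by simp
      then show ?thesis using A0 unfolding quadric_recenter True Kq by simp
    qed
    then have "?X = {q}" using q by blast
    then show ?thesis using pieces_le_connected[of "{q}"] plane_regions_pos pieces_le_mono
      by (metis connected_sing)
  next
    case nz: False
    have "DIM(real^3) = Suc DIM(real^2)" by simp
    then obtain \<phi> :: "real^2 \<Rightarrow> real^3" where \<phi>: "continuous_on UNIV \<phi>" "range \<phi> = quadric A0 b0 C0 - {q}"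
      and cl: "q \<in> closure (range \<phi>)"
      and pull: "\<And>A' b' C'. \<exists>b'' C''. \<forall>y. \<phi> y \<in> quadric A' b' C' \<longleftrightarrow> y \<in> quadric (A' * (q \<bullet> q) + b' \<bullet> q + C') b'' C''"
      by (rule quadric_stereographic[OF _ A0 q(2) nz]) blast+
    define L where "L i = A i * (q \<bullet> q) + b i \<bullet> q + C i" for i
    have "\<forall>i. \<exists>b'' C''. \<forall>y. \<phi> y \<in> quadric (A i) (b i) (C i) \<longleftrightarrow> y \<in> quadric (L i) b'' C''"
      unfolding L_def using pull by blast
    then obtain b'' C'' where bC: "\<And>i y. \<phi> y \<in> quadric (A i) (b i) (C i) \<longleftrightarrow> y \<in> quadric (L i) (b'' i) (C'' i)"
      by metis
    have L: "L i \<noteq> 0" if "i \<in> I" for i using q(1) that by (auto simp: L_def off_quadrics_def quadric_def)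
    have Y: "pieces_le (off_quadrics I L b'' C'') (plane_regions (card I))"
      using L I by (intro pieces_le_off_quadrics_plane) auto
    have yoff: "y \<in> off_quadrics I L b'' C'' \<longleftrightarrow> \<phi> y \<in> off_quadrics I A b C" for y
      using bC by (simp add: off_quadrics_def)
    have im: "\<phi> ` off_quadrics I L b'' C'' = ?X - {q}"
    proof
      show "\<phi> ` off_quadrics I L b'' C'' \<subseteq> ?X - {q}" using yoff \<phi>(2) by auto
      show "?X - {q} \<subseteq> \<phi> ` off_quadrics I L b'' C''"
      proof
        fix x assume x: "x \<in> ?X - {q}"
        then have "x \<in> range \<phi>" unfolding \<phi>(2) by auto
        then obtain y where y: "x = \<phi> y" by blast
        then show "x \<in> \<phi> ` off_quadrics I L b'' C''" using x yoff by auto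
      qed
    qed
    have "q \<in> closure (off_quadrics I A b C \<inter> range \<phi>)"
      using cl q(1) open_Int_closure_subset[OF open_off_quadrics[OF I]] by blast
    also have "off_quadrics I A b C \<inter> range \<phi> = ?X - {q}" unfolding \<phi>(2) by auto
    finally have "?X \<subseteq> closure (?X - {q})" using closure_subset[of "?X - {q}"] by auto
    then show ?thesis
      using im \<phi>(1)
      by (intro pieces_le_dense_image[of _ \<phi> ?X, OF _ _ _ Y]) (auto intro: continuous_on_subset)
  qed
qed

lemma pieces_le_off_spheres_space:
  fixes b :: "'i \<Rightarrow> real^3"
  assumes I: "finite I" "\<forall>i\<in>I. A i \<noteq> 0"
  shows "pieces_le (off_quadrics I A b C) (space_regions (card I))"
  using I
proof (induction I rule: finite_induct)
  case empty
  then show ?case using pieces_le_connected[OF connected_UNIV] by (simp add: off_quadrics_def)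
next
  case (insert i I)
  have "pieces_le (off_quadrics I A b C - quadric (A i) (b i) (C i)) (space_regions (card I) + plane_regions (card I))"
  proof (rule pieces_le_remove_quadric)
    show "open (off_quadrics I A b C)" by (rule open_off_quadrics) fact
    show "2 \<le> DIM(real^3)" "A i \<noteq> 0" using insert.prems by auto
    show "pieces_le (off_quadrics I A b C) (space_regions (card I))" using insert by blast
    show "pieces_le (off_quadrics I A b C \<inter> quadric (A i) (b i) (C i)) (plane_regions (card I))"
      using insert.hyps(1) insert.prems by (intro pieces_le_off_quadrics_surface) auto
  qed
  then show ?case using insert by (simp add: off_quadrics_insert)
qed

text \<open>Planes are allowed here: inverting at a point off all the quadrics turns each of them into
  one with nonzero leading coefficient.\<close>

lemma pieces_le_off_quadrics_space:
  fixes b :: "'i \<Rightarrow> real^3"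
  assumes I: "finite I"
  shows "pieces_le (off_quadrics I A b C) (space_regions (card I))"
proof (cases "off_quadrics I A b C = {}")
  case True then show ?thesis by (metis pieces_le_empty)
next
  case False
  then obtain q where q: "q \<in> off_quadrics I A b C" by auto
  define L where "L i = A i * (q \<bullet> q) + b i \<bullet> q + C i" for i
  define v where "v i = (2 * A i) *\<^sub>R q + b i" for i
  define \<phi> where "\<phi> w = q + (1 / (w \<bullet> w)) *\<^sub>R w" for w :: "real^3"
  have iff: "\<phi> w \<in> quadric (A i) (b i) (C i) \<longleftrightarrow> w \<in> quadric (L i) (v i) (A i)" if "w \<noteq> 0" for w i
  proof -
    have "w \<in> quadric (L i) (v i) (A i) \<longleftrightarrow> L i * (w \<bullet> w) + v i \<bullet> w + A i = 0" by (simp add: quadric_def)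
    then show ?thesis
      unfolding \<phi>_def inversion_in_quadric_iff[OF that] L_def v_def by (simp add: ac_simps)
  qed
  have L: "L i \<noteq> 0" if "i \<in> I" for i using q(1) that by (auto simp: L_def off_quadrics_def quadric_def)
  let ?Y = "off_quadrics I L v A"
  \<comment> \<open>The origin is removed because it corresponds to the point at infinity; deleting
    it costs no piece.\<close>
  have Y: "pieces_le (?Y - {0}) (space_regions (card I))"
    using L I by (intro pieces_le_remove_point pieces_le_off_spheres_space open_off_quadrics) auto
  have im: "\<phi> ` (?Y - {0}) = off_quadrics I A b C - {q}"
  proof
    show "\<phi> ` (?Y - {0}) \<subseteq> off_quadrics I A b C - {q}"
    proof (rule image_subsetI)
      fix w assume w: "w \<in> ?Y - {0}"
      then have "\<phi> w \<in> off_quadrics I A b C" using iff unfolding off_quadrics_def by blast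
      moreover have "\<phi> w \<noteq> q" using w by (simp add: \<phi>_def)
      ultimately show "\<phi> w \<in> off_quadrics I A b C - {q}" by blast
    qed
    show "off_quadrics I A b C - {q} \<subseteq> \<phi> ` (?Y - {0})"
    proof
      fix x assume x: "x \<in> off_quadrics I A b C - {q}"
      define u where "u = (1 / ((x - q) \<bullet> (x - q))) *\<^sub>R (x - q)"
      have u0: "u \<noteq> 0" using x by (simp add: u_def)
      have uu: "u \<bullet> u = 1 / ((x - q) \<bullet> (x - q))" using x by (simp add: u_def)
      have xu: "\<phi> u = x" unfolding \<phi>_def uu using x by (simp add: u_def)
      then show "x \<in> \<phi> ` (?Y - {0})" using x u0 iff[OF u0]
        unfolding off_quadrics_def by (intro image_eqI[of _ _ u]) auto
    qed
  qed
  \<comment> \<open>The centre \<open>q\<close> is not in the image of the inversion, but the set is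
    open, so \<open>q\<close> is a limit of its other points.\<close>
  have "off_quadrics I A b C \<subseteq> closure (off_quadrics I A b C - {q})"
  proof
    fix x assume x: "x \<in> off_quadrics I A b C"
    show "x \<in> closure (off_quadrics I A b C - {q})"
    proof (cases "x = q")
      case True
      then show ?thesis using x open_off_quadrics[OF I]
        by (metis interior_limit_point interior_open islimpt_in_closure)
    next
      case False
      then have "x \<in> off_quadrics I A b C - {q}" using x by simp
      then show ?thesis by (rule subsetD[OF closure_subset])
    qed
  qed
  moreover have "continuous_on (?Y - {0}) \<phi>" unfolding \<phi>_def by (intro continuous_intros) auto
  ultimately show ?thesis
    using im by (intro pieces_le_dense_image[of _ \<phi>, OF _ _ _ Y]) auto
qed

section \<open>Stability of polygonal knots\<close>

lemma ambient_isotopicI: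
  assumes "continuous_on ({0..1} \<times> UNIV) (\<lambda>(t, x). H t x)"
    and "\<And>t. t \<in> {0..1::real} \<Longrightarrow> \<exists>g. homeomorphism UNIV UNIV (H t) g"
    and "H 0 = id" "H 1 ` K = L"
  shows "ambient_isotopic K L"
proof -
  have "homotopic_with_canon (\<lambda>h. \<exists>g. homeomorphism UNIV UNIV h g) UNIV UNIV id (H 1)"
    unfolding homotopic_with_def prod_topology_subtopology_eu
    by (rule exI[of _ "\<lambda>(t, x). H t x"]) (use assms in \<open>auto simp: fun_eq_iff\<close>)
  then show ?thesis using assms(4) unfolding ambient_isotopic_def by blast
qed

lemma ambient_isotopic_trans:
  assumes "ambient_isotopic K L" "ambient_isotopic L M"
  shows "ambient_isotopic K M"
proof -
  let ?P = "\<lambda>h :: real^3 \<Rightarrow> real^3. \<exists>g. homeomorphism UNIV UNIV h g"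
  obtain f where f: "homotopic_with_canon ?P UNIV UNIV id f" "f ` K = L"
    using assms unfolding ambient_isotopic_def by blast
  obtain g where g: "homotopic_with_canon ?P UNIV UNIV id g" "g ` L = M"
    using assms unfolding ambient_isotopic_def by blast
  obtain f' where f': "homeomorphism UNIV UNIV f f'" using homotopic_with_imp_property[OF f(1)] by blast
  \<comment> \<open>The condition along the path is first rephrased for \<open>h \<circ> f\<close>,
    so that composing with \<open>f\<close> on the right leaves a path of homeomorphisms from
    \<open>f\<close>.\<close>
  have "homotopic_with_canon (\<lambda>h. ?P (h \<circ> f)) UNIV UNIV id g"
    using g(1) by (rule homotopic_with_mono) (use f' in \<open>blast intro: homeomorphism_compose\<close>)
  then have "homotopic_with_canon ?P UNIV UNIV (id \<circ> f) (g \<circ> f)"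
    using f' by (intro homotopic_with_compose_continuous_right[where X = UNIV]) (auto simp: homeomorphism_def)
  then have "homotopic_with_canon ?P UNIV UNIV id (g \<circ> f)"
    using homotopic_with_trans[OF f(1)] by simp
  moreover have "(g \<circ> f) ` K = M" using f(2) g(2) by (metis image_comp)
  ultimately show ?thesis unfolding ambient_isotopic_def by blast
qed

text \<open>Composing the path from \<open>id\<close> to \<open>f\<close> on the right with the
  inverse of \<open>f\<close> gives a path from that inverse to \<open>id\<close>, which is then
  reversed. This avoids inverting every member of the path.\<close>

lemma ambient_isotopic_sym:
  assumes "ambient_isotopic K L"
  shows "ambient_isotopic L K"
proof -
  let ?P = "\<lambda>h :: real^3 \<Rightarrow> real^3. \<exists>g. homeomorphism UNIV UNIV h g"
  obtain f where f: "homotopic_with_canon ?P UNIV UNIV id f" "f ` K = L"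
    using assms unfolding ambient_isotopic_def by blast
  obtain f' where f': "homeomorphism UNIV UNIV f f'" using homotopic_with_imp_property[OF f(1)] by blast
  have h': "homeomorphism UNIV UNIV f' f" using f' homeomorphism_symD by blast
  have "homotopic_with_canon (\<lambda>h. ?P (h \<circ> f')) UNIV UNIV id f"
    using f(1) by (rule homotopic_with_mono) (use h' in \<open>blast intro: homeomorphism_compose\<close>)
  then have "homotopic_with_canon ?P UNIV UNIV (id \<circ> f') (f \<circ> f')"
    using f' by (intro homotopic_with_compose_continuous_right[where X = UNIV]) (auto simp: homeomorphism_def)
  moreover have "f \<circ> f' = id" using f' by (auto simp: homeomorphism_def)
  ultimately have "homotopic_with_canon ?P UNIV UNIV id f'" by (simp add: homotopic_with_sym)
  moreover have "f' (f x) = x" for x using f' by (simp add: homeomorphism_def)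
  then have "f' ` L = K" unfolding f(2)[symmetric] image_image by simp
  ultimately show ?thesis unfolding ambient_isotopic_def by (intro exI[of _ f'] conjI)
qed

lemma knot_type_eqI: "ambient_isotopic K L \<Longrightarrow> knot_type K = knot_type L"
  unfolding knot_type_def
  by (rule Collect_cong) (metis ambient_isotopic_sym ambient_isotopic_trans)

text \<open>Solving \<open>x + D x = y\<close> is a fixed point problem for the contraction
  \<open>y - D x\<close>, which gives surjectivity. The lower bound \<open>1 - L\<close> on the
  expansion gives injectivity and a Lipschitz inverse.\<close>

lemma homeomorphism_lipschitz_perturbation:
  fixes D :: "'a::euclidean_space \<Rightarrow> 'a"
  assumes L: "0 \<le> L" "L < 1" and D: "\<And>x y. dist (D x) (D y) \<le> L * dist x y"
  shows "\<exists>g. homeomorphism UNIV UNIV (\<lambda>x. x + D x) g"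
proof -
  define h where "h x = x + D x" for x
  have lb: "(1 - L) * dist x y \<le> dist (h x) (h y)" for x y
  proof -
    have "x - y = (h x - h y) - (D x - D y)" by (simp add: h_def)
    then have "norm (x - y) \<le> norm (h x - h y) + norm (D x - D y)" by (metis norm_triangle_ineq4)
    then show ?thesis using D[of x y] by (simp add: dist_norm algebra_simps)
  qed
  have ex: "\<exists>x. h x = y" for y
  proof -
    have "\<exists>!x. y - D x = x"
      using D by (intro banach_fix_type[OF L]) (simp add: dist_norm norm_minus_commute)
    then show ?thesis by (metis h_def diff_add_cancel)
  qed
  have inj: "x = y" if "h x = h y" for x y
  proof -
    have "(1 - L) * dist x y \<le> 0" using lb[of x y] that by simp
    then show ?thesis using L by (simp add: mult_le_0_iff)
  qed
  obtain g where hg: "\<And>y. h (g y) = y" using ex by metis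
  have gh: "g (h x) = x" for x by (rule inj) (rule hg)
  have "(1 / (1 - L))-lipschitz_on UNIV g"
  proof (rule lipschitz_onI)
    fix x y
    show "dist (g x) (g y) \<le> 1 / (1 - L) * dist x y"
    proof -
      have "(1 - L) * dist (g x) (g y) \<le> dist x y" using lb[of "g x" "g y"] unfolding hg .
      then show ?thesis using L by (simp add: pos_le_divide_eq mult.commute)
    qed
  qed (use L in simp)
  then have "continuous_on UNIV g" by (rule lipschitz_on_continuous_on)
  moreover have "L-lipschitz_on UNIV D" using D L by (intro lipschitz_onI) auto
  then have "continuous_on UNIV h" unfolding h_def by (intro continuous_intros lipschitz_on_continuous_on)
  ultimately have "homeomorphism UNIV UNIV h g"
    using hg gh unfolding homeomorphism_def by (auto simp: surj_def) metis+
  then show ?thesis unfolding h_def by blast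
qed

text \<open>McShane's extension formula; the data may be given by a non-injective parametrisation.\<close>

lemma lipschitz_extension:
  fixes \<gamma> :: "'i \<Rightarrow> 'a::metric_space" and h :: "'i \<Rightarrow> real"
  assumes I: "I \<noteq> {}" and L: "0 \<le> L" and h: "\<And>a b. a \<in> I \<Longrightarrow> b \<in> I \<Longrightarrow> \<bar>h a - h b\<bar> \<le> L * dist (\<gamma> a) (\<gamma> b)"
  obtains F where "\<And>x y. \<bar>F x - F y\<bar> \<le> L * dist x y" "\<And>a. a \<in> I \<Longrightarrow> F (\<gamma> a) = h a"
proof -
  define F where "F x = (INF a\<in>I. h a + L * dist x (\<gamma> a))" for x
  obtain a0 where a0: "a0 \<in> I" using I by blast
  have bdd: "bdd_below ((\<lambda>a. h a + L * dist x (\<gamma> a)) ` I)" for x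
  proof (rule bdd_belowI2)
    fix a assume a: "a \<in> I"
    have "L * dist (\<gamma> a) (\<gamma> a0) \<le> L * (dist x (\<gamma> a) + dist x (\<gamma> a0))"
      using L dist_triangle[of "\<gamma> a" "\<gamma> a0" x] by (intro mult_left_mono) (auto simp: dist_commute)
    then show "h a0 - L * dist x (\<gamma> a0) \<le> h a + L * dist x (\<gamma> a)"
      using h[OF a a0] by (simp add: algebra_simps)
  qed
  have le: "F x \<le> F y + L * dist x y" for x y
  proof -
    have "F x - L * dist x y \<le> F y" unfolding F_def[of y]
    proof (rule cINF_greatest[OF I])
      fix a assume a: "a \<in> I"
      have "F x \<le> h a + L * dist x (\<gamma> a)" unfolding F_def by (rule cINF_lower[OF bdd a])
      also have "\<dots> \<le> h a + L * (dist x y + dist y (\<gamma> a))"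
        using L by (intro add_left_mono mult_left_mono dist_triangle)
      finally show "F x - L * dist x y \<le> h a + L * dist y (\<gamma> a)" by (simp add: algebra_simps)
    qed
    then show ?thesis by simp
  qed
  show ?thesis
  proof
    show "\<bar>F x - F y\<bar> \<le> L * dist x y" for x y
      using le[of x y] le[of y x] by (simp add: dist_commute abs_le_iff)
    show "F (\<gamma> a) = h a" if a: "a \<in> I" for a
    proof (rule antisym)
      show "F (\<gamma> a) \<le> h a" unfolding F_def using cINF_lower[OF bdd a, of "\<gamma> a"] by simp
      show "h a \<le> F (\<gamma> a)" unfolding F_def
      proof (rule cINF_greatest[OF I])
        fix b assume b: "b \<in> I"
        then show "h a \<le> h b + L * dist (\<gamma> a) (\<gamma> b)" using h[OF a b] by simp
      qed
    qed
  qed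
qed

section \<open>Hat functions of the vertices and their Lipschitz constants\<close>

definition segment_point :: "(real^3) list \<Rightarrow> nat \<Rightarrow> real \<Rightarrow> real^3" where
  "segment_point vs j s = (1 - s) *\<^sub>R (vs ! j) + s *\<^sub>R (vs ! (Suc j mod length vs))"

lemma polygon_edge_segment_point: "polygon_edge vs j = segment_point vs j ` {0..1}"
  unfolding polygon_edge_def segment_point_def closed_segment_image_interval by simp

lemma closed_polygon_segment_point:
  "closed_polygon vs = (\<lambda>(j, s). segment_point vs j s) ` ({..<length vs} \<times> {0..1})"
  unfolding closed_polygon_def polygon_edge_segment_point by auto

text \<open>The value at parameter \<open>s\<close> of edge \<open>j\<close> of the piecewise linear
  function on the polygon that is 1 at vertex \<open>i\<close> and 0 at the other vertices.\<close>

definition hat :: "nat \<Rightarrow> nat \<Rightarrow> nat \<Rightarrow> real \<Rightarrow> real" where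
  "hat n i j s = (if i = j then 1 - s else 0) + (if i = Suc j mod n then s else 0)"

lemma hat_bounds: "s \<in> {0..1} \<Longrightarrow> 2 \<le> n \<Longrightarrow> j < n \<Longrightarrow> 0 \<le> hat n i j s \<and> hat n i j s \<le> 1"
  by (auto simp: hat_def mod_Suc split: if_splits)

text \<open>By homogeneity only \<open>s + t = 1\<close> matters, a compact range on which the norm
  attains its minimum. A zero minimum would produce a common point of the two segments other than
  \<open>v\<close>.\<close>

lemma angle_lower_bound:
  fixes a b :: "'a::euclidean_space"
  assumes meet: "closed_segment v (v + a) \<inter> closed_segment v (v + b) = {v}" and nz: "a \<noteq> 0" "b \<noteq> 0"
  obtains c where "c > 0" "\<And>s t. s \<ge> 0 \<Longrightarrow> t \<ge> 0 \<Longrightarrow> c * (s + t) \<le> norm (s *\<^sub>R a - t *\<^sub>R b)"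
proof -
  define f where "f s = norm (s *\<^sub>R a - (1 - s) *\<^sub>R b)" for s
  have "continuous_on {0..1} f" unfolding f_def by (intro continuous_intros)
  then obtain s0 where s0: "s0 \<in> {0..1}" "\<And>s. s \<in> {0..1} \<Longrightarrow> f s0 \<le> f s"
    using continuous_attains_inf[of "{0..1::real}" f] by auto
  have pos: "f s0 > 0"
  proof (rule ccontr)
    assume "\<not> f s0 > 0"
    then have eq: "s0 *\<^sub>R a = (1 - s0) *\<^sub>R b" by (simp add: f_def)
    have 1: "v + s0 *\<^sub>R a \<in> closed_segment v (v + a)" using s0(1)
      by (auto simp: in_segment algebra_simps intro!: exI[of _ s0])
    have "v + (1 - s0) *\<^sub>R b \<in> closed_segment v (v + b)" using s0(1)
      by (auto simp: in_segment algebra_simps intro!: exI[of _ "1 - s0"])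
    then have "v + s0 *\<^sub>R a = v" using 1 meet unfolding eq by blast
    then have "s0 = 0" using nz by simp
    then show False using eq nz by simp
  qed
  show ?thesis
  proof (rule that[OF pos])
    fix s t :: real assume st: "s \<ge> 0" "t \<ge> 0"
    show "f s0 * (s + t) \<le> norm (s *\<^sub>R a - t *\<^sub>R b)"
    proof (cases "s + t = 0")
      case True then show ?thesis using st by simp
    next
      case False
      then have p: "s + t > 0" using st by simp
      have "s *\<^sub>R a - t *\<^sub>R b = (s + t) *\<^sub>R ((s / (s + t)) *\<^sub>R a - (1 - s / (s + t)) *\<^sub>R b)"
      proof -
        have "1 - s / (s + t) = t / (s + t)" using p by (simp add: field_simps)
        then show ?thesis using p by (simp add: scaleR_diff_right)
      qed
      then have "norm (s *\<^sub>R a - t *\<^sub>R b) = (s + t) * f (s / (s + t))"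
        using p by (simp add: f_def)
      moreover have "f s0 \<le> f (s / (s + t))" using st p by (intro s0) auto
      ultimately show ?thesis using p by (simp add: mult.commute)
    qed
  qed
qed

lemma hat_lipschitz_same:
  assumes K: "polygonal_knot vs" and j: "j < length vs"
  shows "\<exists>L\<ge>0. \<forall>i. \<forall>s\<in>{0..1}. \<forall>t\<in>{0..1}.
    \<bar>hat (length vs) i j s - hat (length vs) i j t\<bar> \<le> L * dist (segment_point vs j s) (segment_point vs j t)"
proof -
  let ?n = "length vs"
  have n: "?n \<ge> 3" "distinct vs" using K by (auto simp: polygonal_knot_def)
  have ne: "Suc j mod ?n \<noteq> j" using n j by (auto simp: mod_Suc)
  let ?w = "vs ! (Suc j mod ?n) - vs ! j"
  have "Suc j mod ?n < ?n" using n by (intro mod_less_divisor) linarith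
  then have w: "norm ?w > 0" using n ne j by (simp add: nth_eq_iff_index_eq)
  have d: "dist (segment_point vs j s) (segment_point vs j t) = \<bar>s - t\<bar> * norm ?w" for s t
  proof -
    have "segment_point vs j s - segment_point vs j t = (s - t) *\<^sub>R ?w"
      by (simp add: segment_point_def algebra_simps)
    then show ?thesis by (simp add: dist_norm)
  qed
  have "\<bar>hat ?n i j s - hat ?n i j t\<bar> \<le> \<bar>s - t\<bar>" for i s t using ne by (auto simp: hat_def)
  then have "\<bar>hat ?n i j s - hat ?n i j t\<bar> \<le> 1 / norm ?w * dist (segment_point vs j s) (segment_point vs j t)" for i s t
    using w unfolding d by simp
  then show ?thesis using w by (intro exI[of _ "1 / norm ?w"]) simp
qed

text \<open>Points of the two edges come arbitrarily close near the shared vertex. Measured from it,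
  their parameters are \<open>1 - s\<close> and \<open>t\<close>; the angle bound controls their sum
  by the distance, and this sum dominates the change of every hat function.\<close>

lemma hat_lipschitz_adjacent:
  assumes K: "polygonal_knot vs" and j: "j < length vs" and k: "k = Suc j mod length vs"
  shows "\<exists>L\<ge>0. \<forall>i. \<forall>s\<in>{0..1}. \<forall>t\<in>{0..1}.
    \<bar>hat (length vs) i j s - hat (length vs) i k t\<bar> \<le> L * dist (segment_point vs j s) (segment_point vs k t)"
proof -
  let ?n = "length vs"
  have n: "?n \<ge> 3" "distinct vs" using K by (auto simp: polygonal_knot_def)
  define l where "l = Suc k mod ?n"
  have ne: "k \<noteq> j" "l \<noteq> k" "l \<noteq> j" "k < ?n" "l < ?n"
    using n j unfolding l_def k by (auto simp: mod_Suc)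
  define a where "a = vs ! j - vs ! k"
  define b where "b = vs ! l - vs ! k"
  have nz: "a \<noteq> 0" "b \<noteq> 0" using n ne j by (auto simp: a_def b_def nth_eq_iff_index_eq)
  have "polygon_edge vs j \<inter> polygon_edge vs k = {vs ! j, vs ! k} \<inter> {vs ! k, vs ! l}"
    using K ne j unfolding polygonal_knot_def l_def k by blast
  also have "\<dots> = {vs ! k}" using n ne j by (auto simp: nth_eq_iff_index_eq)
  finally have "closed_segment (vs ! k) (vs ! k + a) \<inter> closed_segment (vs ! k) (vs ! k + b) = {vs ! k}"
    unfolding polygon_edge_def l_def[symmetric] k[symmetric]
    by (simp add: a_def b_def closed_segment_commute)
  then obtain c where c: "c > 0" "\<And>s t. s \<ge> 0 \<Longrightarrow> t \<ge> 0 \<Longrightarrow> c * (s + t) \<le> norm (s *\<^sub>R a - t *\<^sub>R b)"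
    using angle_lower_bound[OF _ nz] by metis
  have d: "dist (segment_point vs j s) (segment_point vs k t) = norm ((1 - s) *\<^sub>R a - t *\<^sub>R b)" for s t
  proof -
    have "segment_point vs j s - segment_point vs k t = (1 - s) *\<^sub>R a - t *\<^sub>R b"
      by (simp add: segment_point_def a_def b_def l_def[symmetric] k[symmetric] algebra_simps)
    then show ?thesis by (simp add: dist_norm)
  qed
  have "\<bar>hat ?n i j s - hat ?n i k t\<bar> \<le> 1 / c * dist (segment_point vs j s) (segment_point vs k t)"
    if st: "s \<in> {0..1}" "t \<in> {0..1}" for i s t
  proof -
    have "\<bar>hat ?n i j s - hat ?n i k t\<bar> \<le> (1 - s) + t"
      using st ne unfolding hat_def l_def[symmetric] k[symmetric] by auto
    also have "\<dots> \<le> 1 / c * norm ((1 - s) *\<^sub>R a - t *\<^sub>R b)"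
      using c(2)[of "1 - s" t] c(1) st by (simp add: field_simps)
    finally show ?thesis unfolding d .
  qed
  then show ?thesis using c by (intro exI[of _ "1 / c"]) simp
qed

text \<open>Disjoint compact edges have a positive distance, while hat values differ by at most
  1.\<close>

lemma hat_lipschitz_disjoint:
  assumes K: "polygonal_knot vs" and j: "j < length vs" "k < length vs" "j \<noteq> k"
    and nonadj: "k \<noteq> Suc j mod length vs" "j \<noteq> Suc k mod length vs"
  shows "\<exists>L\<ge>0. \<forall>i. \<forall>s\<in>{0..1}. \<forall>t\<in>{0..1}.
    \<bar>hat (length vs) i j s - hat (length vs) i k t\<bar> \<le> L * dist (segment_point vs j s) (segment_point vs k t)"
proof -
  let ?n = "length vs"
  have n: "?n \<ge> 3" "distinct vs" using K by (auto simp: polygonal_knot_def)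
  have ne: "Suc j mod ?n \<noteq> Suc k mod ?n" using n j by (auto simp: mod_Suc split: if_splits)
  have lt: "Suc j mod ?n < ?n" "Suc k mod ?n < ?n" using n by (intro mod_less_divisor; linarith)+
  have "polygon_edge vs j \<inter> polygon_edge vs k = {vs ! j, vs ! (Suc j mod ?n)} \<inter> {vs ! k, vs ! (Suc k mod ?n)}"
    using K j unfolding polygonal_knot_def by blast
  also have "\<dots> = {}" using n ne j lt nonadj by (auto simp: nth_eq_iff_index_eq)
  finally have disj: "polygon_edge vs j \<inter> polygon_edge vs k = {}" .
  obtain d where d: "d > 0" "\<And>x y. x \<in> polygon_edge vs j \<Longrightarrow> y \<in> polygon_edge vs k \<Longrightarrow> d \<le> dist x y"
    using separate_compact_closed[OF _ _ disj] unfolding polygon_edge_def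
    by (metis closed_segment compact_segment)
  have "\<bar>hat ?n i j s - hat ?n i k t\<bar> \<le> 1 / d * dist (segment_point vs j s) (segment_point vs k t)"
    if st: "s \<in> {0..1}" "t \<in> {0..1}" for i s t
  proof -
    have "\<bar>hat ?n i j s - hat ?n i k t\<bar> \<le> 1"
      using hat_bounds[of s ?n j i] hat_bounds[of t ?n k i] st n j by auto
    also have "\<dots> \<le> 1 / d * dist (segment_point vs j s) (segment_point vs k t)"
      using d st by (simp add: polygon_edge_segment_point field_simps)
    finally show ?thesis .
  qed
  then show ?thesis using d by (intro exI[of _ "1 / d"]) simp
qed

text \<open>The bound is in terms of distance in space, not along the polygon, as an extension to
  all of space requires. It also makes each hat function well defined at vertices, where two
  parametrisations give the same point.\<close>

lemma hat_lipschitz: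
  assumes K: "polygonal_knot vs"
  obtains L where "L \<ge> 0" "\<And>i j k s t. j < length vs \<Longrightarrow> k < length vs \<Longrightarrow> s \<in> {0..1} \<Longrightarrow> t \<in> {0..1} \<Longrightarrow>
    \<bar>hat (length vs) i j s - hat (length vs) i k t\<bar> \<le> L * dist (segment_point vs j s) (segment_point vs k t)"
proof -
  let ?n = "length vs"
  let ?P = "\<lambda>j k L. L \<ge> 0 \<and> (\<forall>i. \<forall>s\<in>{0..1}. \<forall>t\<in>{0..1}.
    \<bar>hat ?n i j s - hat ?n i k t\<bar> \<le> L * dist (segment_point vs j s) (segment_point vs k t))"
  have sym: "?P j k L \<Longrightarrow> ?P k j L" for j k L
    by (metis abs_minus_commute dist_commute)
  have "\<exists>L. ?P j k L" if jk: "j < ?n" "k < ?n" for j k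
  proof -
    consider "j = k" | "k = Suc j mod ?n" | "j = Suc k mod ?n" | "j \<noteq> k" "k \<noteq> Suc j mod ?n" "j \<noteq> Suc k mod ?n" by blast
    then show ?thesis
    proof cases
      case 1 then show ?thesis using hat_lipschitz_same[OF K jk(1)] by blast
    next
      case 2 then show ?thesis using hat_lipschitz_adjacent[OF K jk(1)] by blast
    next
      case 3
      obtain L where "?P k j L" using hat_lipschitz_adjacent[OF K jk(2) 3] by blast
      from sym[OF this] show ?thesis by (rule exI)
    next
      case 4 then show ?thesis using hat_lipschitz_disjoint[OF K jk] by blast
    qed
  qed
  then obtain M where M: "\<And>j k. j < ?n \<Longrightarrow> k < ?n \<Longrightarrow> ?P j k (M j k)" by metis
  define L where "L = (\<Sum>p\<in>{..<?n}\<times>{..<?n}. case_prod M p)"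
  have Mle: "M j k \<le> L" if "j < ?n" "k < ?n" for j k
    unfolding L_def using M that member_le_sum[of "(j, k)" "{..<?n}\<times>{..<?n}" "case_prod M"] by auto
  show ?thesis
  proof (rule that[of L])
    show "L \<ge> 0" unfolding L_def using M by (intro sum_nonneg) auto
    fix i j k s t assume *: "j < ?n" "k < ?n" "s \<in> {0..1::real}" "t \<in> {0..1::real}"
    then have "\<bar>hat ?n i j s - hat ?n i k t\<bar> \<le> M j k * dist (segment_point vs j s) (segment_point vs k t)"
      using M by blast
    also have "\<dots> \<le> L * dist (segment_point vs j s) (segment_point vs k t)"
      using Mle * by (intro mult_right_mono) auto
    finally show "\<bar>hat ?n i j s - hat ?n i k t\<bar> \<le> L * dist (segment_point vs j s) (segment_point vs k t)" .
  qed
qed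

text \<open>The Lipschitz extensions of the hat functions of the vertices interpolate the vertex
  displacements linearly along the edges.\<close>

lemma polygonal_knot_stable:
  assumes K: "polygonal_knot vs"
  obtains e where "e > 0" "\<And>ws. length ws = length vs \<Longrightarrow> (\<And>i. i < length vs \<Longrightarrow> dist (ws ! i) (vs ! i) < e) \<Longrightarrow>
    ambient_isotopic (closed_polygon vs) (closed_polygon ws)"
proof -
  let ?n = "length vs"
  have n: "?n \<ge> 3" using K by (auto simp: polygonal_knot_def)
  obtain L where L: "L \<ge> 0" and hL: "\<And>i j k s t. j < ?n \<Longrightarrow> k < ?n \<Longrightarrow> s \<in> {0..1} \<Longrightarrow> t \<in> {0..1} \<Longrightarrow>
    \<bar>hat ?n i j s - hat ?n i k t\<bar> \<le> L * dist (segment_point vs j s) (segment_point vs k t)"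
    using hat_lipschitz[OF K] by blast
  let ?I = "{..<?n} \<times> {0..1::real}"
  have "\<exists>F. (\<forall>x y. \<bar>F x - F y\<bar> \<le> L * dist x y) \<and> (\<forall>j<?n. \<forall>s\<in>{0..1}. F (segment_point vs j s) = hat ?n i j s)" for i
  proof -
    have "0 < ?n" using n by linarith
    then have "(0, 0) \<in> ?I" by simp
    then have I: "?I \<noteq> {}" by blast
    have h: "\<bar>case_prod (hat ?n i) a - case_prod (hat ?n i) b\<bar> \<le>
        L * dist (case_prod (segment_point vs) a) (case_prod (segment_point vs) b)" if "a \<in> ?I" "b \<in> ?I" for a b
      using that hL by auto
    obtain F where F: "\<And>x y. \<bar>F x - F y\<bar> \<le> L * dist x y" "\<And>a. a \<in> ?I \<Longrightarrow> F (case_prod (segment_point vs) a) = case_prod (hat ?n i) a"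
      by (rule lipschitz_extension[of ?I L "case_prod (hat ?n i)" "case_prod (segment_point vs)", OF I L h]) blast+
    show ?thesis using F(1) F(2)[of "(_, _)"] by (intro exI[of _ F]) auto
  qed
  then obtain \<phi> where \<phi>: "\<And>i x y. \<bar>\<phi> i x - \<phi> i y\<bar> \<le> L * dist x y"
    and \<phi>hat: "\<And>i j s. j < ?n \<Longrightarrow> s \<in> {0..1} \<Longrightarrow> \<phi> i (segment_point vs j s) = hat ?n i j s" by metis
  \<comment> \<open>Each of the \<open>length vs\<close> summands of the displacement has Lipschitz
    constant at most \<open>L * e\<close>; this choice makes their total at most 1/2, so the
    displacement is a contraction, also after scaling by \<open>t\<close> in the unit
    interval.\<close>
  define e where "e = 1 / (2 * ?n * (L + 1))"
  have n0: "real ?n > 0" using n by linarith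
  have e: "e > 0" unfolding e_def using n0 L by (intro divide_pos_pos mult_pos_pos) auto
  have "?n * (L * e) = L / (2 * (L + 1))" unfolding e_def using n0 by simp
  also have "\<dots> \<le> 1 / 2" using L by (simp add: field_simps)
  finally have ne: "?n * (L * e) \<le> 1 / 2" .
  show ?thesis
  proof (rule that[OF e])
    fix ws assume len: "length ws = ?n" and close: "\<And>i. i < ?n \<Longrightarrow> dist (ws ! i) (vs ! i) < e"
    define D where "D x = (\<Sum>i<?n. \<phi> i x *\<^sub>R (ws ! i - vs ! i))" for x
    have DL: "dist (D x) (D y) \<le> 1/2 * dist x y" for x y
    proof -
      have "D x - D y = (\<Sum>i<?n. (\<phi> i x - \<phi> i y) *\<^sub>R (ws ! i - vs ! i))"
        by (simp add: D_def sum_subtractf scaleR_left_diff_distrib)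
      also have "norm \<dots> \<le> (\<Sum>i<?n. (L * dist x y) * e)"
      proof (rule sum_norm_le)
        fix i assume "i \<in> {..<?n}"
        then have "norm (ws ! i - vs ! i) \<le> e" using close[of i] by (simp add: dist_norm)
        then show "norm ((\<phi> i x - \<phi> i y) *\<^sub>R (ws ! i - vs ! i)) \<le> L * dist x y * e"
          using \<phi>[of i x y] L e by (simp add: mult_mono)
      qed
      also have "\<dots> = ?n * (L * e) * dist x y" by simp
      also have "\<dots> \<le> 1/2 * dist x y" using ne by (intro mult_right_mono) auto
      finally show ?thesis by (simp add: dist_norm)
    qed
    have contD: "continuous_on UNIV D"
      by (rule lipschitz_on_continuous_on[of "1/2"]) (auto intro: lipschitz_onI DL)
    define H where "H t x = x + t *\<^sub>R D x" for t x
    show "ambient_isotopic (closed_polygon vs) (closed_polygon ws)"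
    proof (rule ambient_isotopicI[of H])
      have "continuous_on ({0..1} \<times> UNIV) (\<lambda>p. H (fst p) (snd p))"
        unfolding H_def by (intro continuous_intros continuous_on_compose2[OF contD]) auto
      then show "continuous_on ({0..1} \<times> UNIV) (\<lambda>(t, x). H t x)" by (simp add: case_prod_unfold)
      show "H 0 = id" by (auto simp: H_def)
      show "\<exists>g. homeomorphism UNIV UNIV (H t) g" if t: "t \<in> {0..1}" for t
        unfolding H_def
      proof (rule homeomorphism_lipschitz_perturbation[of "1/2"])
        fix x y
        have "dist (t *\<^sub>R D x) (t *\<^sub>R D y) = t * dist (D x) (D y)" using t
          by (simp add: dist_norm scaleR_diff_right[symmetric])
        also have "\<dots> \<le> 1 * dist (D x) (D y)" using t by (intro mult_right_mono) auto
        finally show "dist (t *\<^sub>R D x) (t *\<^sub>R D y) \<le> 1/2 * dist x y" using DL[of x y] by linarith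
      qed auto
      have "H 1 (segment_point vs j s) = segment_point ws j s" if "j < ?n" "s \<in> {0..1}" for j s
      proof -
        have m: "Suc j mod ?n < ?n" using n by (intro mod_less_divisor) linarith
        have "D (segment_point vs j s) = (\<Sum>i<?n. hat ?n i j s *\<^sub>R (ws ! i - vs ! i))"
          unfolding D_def using \<phi>hat[OF that] by simp
        also have "\<dots> = (\<Sum>i<?n. if i = j then (1 - s) *\<^sub>R (ws ! i - vs ! i) else 0)
           + (\<Sum>i<?n. if i = Suc j mod ?n then s *\<^sub>R (ws ! i - vs ! i) else 0)"
          unfolding sum.distrib[symmetric] by (rule sum.cong) (auto simp: hat_def scaleR_left_distrib)
        also have "\<dots> = (1 - s) *\<^sub>R (ws ! j - vs ! j) + s *\<^sub>R (ws ! (Suc j mod ?n) - vs ! (Suc j mod ?n))"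
          using that m by simp
        finally show ?thesis unfolding H_def by (simp add: segment_point_def len algebra_simps)
      qed
      then show "H 1 ` closed_polygon vs = closed_polygon ws"
        unfolding closed_polygon_segment_point len image_image by (intro image_cong) auto
    qed
  qed
qed

section \<open>Inversion of polygons\<close>

text \<open>The coefficients of a quadric form a five-dimensional space and each point imposes one
  linear condition, so four points leave a nonzero solution, in whatever position they are.\<close>

lemma quadric_through_four_points:
  fixes x1 x2 x3 x4 :: "real^3"
  obtains A b C where "(A, b, C) \<noteq> (0, 0, 0)" "{x1, x2, x3, x4} \<subseteq> quadric A b C"
proof -
  define V where "V x = (x \<bullet> x, x, 1::real)" for x :: "real^3"
  let ?S = "{V x1, V x2, V x3, V x4}"
  have "dim ?S \<le> card ?S" by (rule dim_le_card') simp
  also have "\<dots> \<le> 4" by (simp add: card_insert_if)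
  also have "\<dots> < DIM(real \<times> (real^3) \<times> real)" by simp
  finally obtain u where u: "u \<noteq> 0" "\<And>y. y \<in> span ?S \<Longrightarrow> orthogonal u y"
    using orthogonal_to_subspace_exists by blast
  obtain A b C where uabc: "u = (A, b, C)" by (cases u) auto
  have "x \<in> quadric A b C" if "V x \<in> ?S" for x
  proof -
    have "orthogonal u (V x)" using that by (intro u(2) span_base)
    then show ?thesis by (simp add: uabc V_def orthogonal_def quadric_def)
  qed
  then show ?thesis using u(1) by (intro that[of A b C]) (auto simp: uabc zero_prod_def)
qed

text \<open>On a ball around \<open>z\<close> inside the quadric, adding the equations at
  \<open>u\<close> and \<open>-u\<close> removes the linear term and forces \<open>A = 0\<close>;
  testing along the gradient then forces it to vanish as well.\<close>

lemma interior_quadric_empty: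
  assumes "(A, b, C) \<noteq> (0, 0, 0)"
  shows "interior (quadric A b C) = {}"
proof (rule ccontr)
  assume "interior (quadric A b C) \<noteq> {}"
  then obtain z e where e: "e > 0" "ball z e \<subseteq> quadric A b C"
    by (metis ex_in_conv mem_interior)
  define v where "v = (2 * A) *\<^sub>R z + b"
  define K where "K = A * (z \<bullet> z) + b \<bullet> z + C"
  have eq: "A * (u \<bullet> u) + v \<bullet> u + K = 0" if "norm u < e" for u
  proof -
    have "z + u \<in> quadric A b C" using e that by (auto simp: dist_norm)
    then show ?thesis unfolding quadric_recenter v_def K_def .
  qed
  have K: "K = 0" using eq[of 0] e by simp
  obtain u :: 'a where u: "norm u = e / 2" using vector_choose_size[of "e/2"] e by auto
  then have "A * (u \<bullet> u) = 0" using eq[of u] eq[of "-u"] e K by simp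
  then have A: "A = 0" using u e by auto
  have "v = 0"
  proof (rule ccontr)
    assume v: "v \<noteq> 0"
    have "norm ((e / (2 * norm v)) *\<^sub>R v) < e" using v e by simp
    from eq[OF this] have "e / (2 * norm v) * (v \<bullet> v) = 0" using A K by simp
    then show False using v e by simp
  qed
  then have "b = 0" using A by (simp add: v_def)
  then show False using A K assms by (simp add: K_def)
qed

lemma closure_off_quadrics:
  assumes "finite I" "\<And>i. i \<in> I \<Longrightarrow> (A i, b i, C i) \<noteq> (0, 0, 0)"
  shows "closure (off_quadrics I A b C) = UNIV"
proof -
  have "interior (\<Union>i\<in>I. quadric (A i) (b i) (C i)) = {}"
    using assms
  proof (induction I rule: finite_induct)
    case (insert i I)
    have "closed (\<Union>i\<in>I. quadric (A i) (b i) (C i))"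
      using insert.hyps(1) by (intro closed_UN) (auto simp: closed_quadric)
    then have "interior ((\<Union>i\<in>I. quadric (A i) (b i) (C i)) \<union> quadric (A i) (b i) (C i)) =
        interior (\<Union>i\<in>I. quadric (A i) (b i) (C i))"
      using insert.prems by (intro interior_closed_Un_empty_interior interior_quadric_empty) auto
    then show ?case using insert by (simp add: Un_commute)
  qed simp
  moreover have "off_quadrics I A b C = - (\<Union>i\<in>I. quadric (A i) (b i) (C i))"
    by (auto simp: off_quadrics_def)
  ultimately show ?thesis by (metis closure_complement Compl_empty_eq)
qed

section \<open>Inverting a polygon at a fixed centre, and varying centre and radius\<close>

lemma sphere_inversion_alt:
  "sphere_inversion p r x = p + (r\<^sup>2 / ((x - p) \<bullet> (x - p))) *\<^sub>R (x - p)"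
  by (simp add: sphere_inversion_def power2_norm_eq_inner)

lemma sphere_inversion_inj:
  assumes "r > 0" "x \<noteq> p" "y \<noteq> p" "sphere_inversion p r x = sphere_inversion p r y"
  shows "x = y"
proof -
  let ?u = "x - p" and ?v = "y - p"
  have eq: "(r\<^sup>2 / (?u \<bullet> ?u)) *\<^sub>R ?u = (r\<^sup>2 / (?v \<bullet> ?v)) *\<^sub>R ?v"
    using assms(4) by (simp add: sphere_inversion_alt)
  have pos: "?u \<bullet> ?u \<noteq> 0" "?v \<bullet> ?v \<noteq> 0" "r\<^sup>2 \<noteq> 0" using assms by auto
  have "((r\<^sup>2 / (?u \<bullet> ?u)) *\<^sub>R ?u) \<bullet> ((r\<^sup>2 / (?u \<bullet> ?u)) *\<^sub>R ?u) =
      ((r\<^sup>2 / (?v \<bullet> ?v)) *\<^sub>R ?v) \<bullet> ((r\<^sup>2 / (?v \<bullet> ?v)) *\<^sub>R ?v)" by (simp only: eq)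
  then have "r\<^sup>2 * r\<^sup>2 / (?u \<bullet> ?u) = r\<^sup>2 * r\<^sup>2 / (?v \<bullet> ?v)" using pos by simp
  then have "?u \<bullet> ?u = ?v \<bullet> ?v" using pos by (simp add: field_simps)
  then have "?u = ?v" using eq pos by simp
  then show ?thesis by simp
qed

text \<open>Dividing the barycentric weights by the squared distances to the centre turns a crossing of the
  inverted segments into a linear relation between the original vertices; evaluating the quadric on
  it shows that the new weights have the same total on both sides, so that the original segments
  cross as well.\<close>

lemma inversion_crossing:
  fixes a b c d p :: "real^3"
  assumes p: "p \<notin> {a, b, c, d}" and r: "r > 0"
    and s: "s \<in> {0..1}" and t: "t \<in> {0..1}"
    and cross: "(1 - s) *\<^sub>R sphere_inversion p r a + s *\<^sub>R sphere_inversion p r b =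
      (1 - t) *\<^sub>R sphere_inversion p r c + t *\<^sub>R sphere_inversion p r d"
    and quad: "{a, b, c, d} \<subseteq> quadric A v0 C" "p \<notin> quadric A v0 C"
  obtains s' t' where "s' \<in> {0..1}" "t' \<in> {0..1}"
    "(1 - s') *\<^sub>R a + s' *\<^sub>R b = (1 - t') *\<^sub>R c + t' *\<^sub>R d"
    "s' = 0 \<Longrightarrow> s = 0" "s' = 1 \<Longrightarrow> s = 1" "t' = 0 \<Longrightarrow> t = 0" "t' = 1 \<Longrightarrow> t = 1"
proof -
  define N where "N x = (x - p) \<bullet> (x - p)" for x
  have N: "N a > 0" "N b > 0" "N c > 0" "N d > 0" using p by (auto simp: N_def)
  define \<alpha> \<beta> \<gamma> \<delta> where "\<alpha> = (1 - s) / N a" and "\<beta> = s / N b" and "\<gamma> = (1 - t) / N c" and "\<delta> = t / N d"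
  have nn: "\<alpha> \<ge> 0" "\<beta> \<ge> 0" "\<gamma> \<ge> 0" "\<delta> \<ge> 0" using s t N by (auto simp: \<alpha>_def \<beta>_def \<gamma>_def \<delta>_def)
  have wt: "\<alpha> * N a + \<beta> * N b = 1" "\<gamma> * N c + \<delta> * N d = 1"
    using N by (auto simp: \<alpha>_def \<beta>_def \<gamma>_def \<delta>_def)
  have inv: "sphere_inversion p r x = p + (r\<^sup>2 / N x) *\<^sub>R (x - p)" for x
    unfolding sphere_inversion_alt N_def ..
  have "(1 - s) *\<^sub>R sphere_inversion p r a + s *\<^sub>R sphere_inversion p r b = p + r\<^sup>2 *\<^sub>R (\<alpha> *\<^sub>R (a - p) + \<beta> *\<^sub>R (b - p))"
    unfolding inv \<alpha>_def \<beta>_def by (simp add: scaleR_add_right scaleR_left_diff_distrib mult.commute)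
  moreover have "(1 - t) *\<^sub>R sphere_inversion p r c + t *\<^sub>R sphere_inversion p r d = p + r\<^sup>2 *\<^sub>R (\<gamma> *\<^sub>R (c - p) + \<delta> *\<^sub>R (d - p))"
    unfolding inv \<gamma>_def \<delta>_def by (simp add: scaleR_add_right scaleR_left_diff_distrib mult.commute)
  ultimately have lin: "\<alpha> *\<^sub>R (a - p) + \<beta> *\<^sub>R (b - p) = \<gamma> *\<^sub>R (c - p) + \<delta> *\<^sub>R (d - p)"
    using cross r by simp
  define v where "v = (2 * A) *\<^sub>R p + v0"
  define K where "K = A * (p \<bullet> p) + v0 \<bullet> p + C"
  have K: "K \<noteq> 0" using quad(2) by (simp add: K_def quadric_def)
  have Q: "A * N x + v \<bullet> (x - p) + K = 0" if "x \<in> {a, b, c, d}" for x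
  proof -
    have "p + (x - p) \<in> quadric A v0 C" using quad(1) that by auto
    then show ?thesis unfolding quadric_recenter v_def K_def N_def .
  qed
  \<comment> \<open>The quadric equation at \<open>a\<close> and \<open>b\<close> is summed with the
    new weights. Their definition makes the quadratic part contribute exactly \<open>A\<close>,
    because the original barycentric weights add up to 1.\<close>
  have 1: "A + v \<bullet> (\<alpha> *\<^sub>R (a - p) + \<beta> *\<^sub>R (b - p)) + K * (\<alpha> + \<beta>) = 0"
  proof -
    have "\<alpha> * (A * N a + v \<bullet> (a - p) + K) + \<beta> * (A * N b + v \<bullet> (b - p) + K) = 0" using Q by simp
    then have "A * (\<alpha> * N a + \<beta> * N b) + (\<alpha> * (v \<bullet> (a - p)) + \<beta> * (v \<bullet> (b - p))) + K * (\<alpha> + \<beta>) = 0"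
      by (simp only: algebra_simps)
    then show ?thesis unfolding wt by (simp only: inner_add_right inner_scaleR_right mult_1_right)
  qed
  have 2: "A + v \<bullet> (\<gamma> *\<^sub>R (c - p) + \<delta> *\<^sub>R (d - p)) + K * (\<gamma> + \<delta>) = 0"
  proof -
    have "\<gamma> * (A * N c + v \<bullet> (c - p) + K) + \<delta> * (A * N d + v \<bullet> (d - p) + K) = 0" using Q by simp
    then have "A * (\<gamma> * N c + \<delta> * N d) + (\<gamma> * (v \<bullet> (c - p)) + \<delta> * (v \<bullet> (d - p))) + K * (\<gamma> + \<delta>) = 0"
      by (simp only: algebra_simps)
    then show ?thesis unfolding wt by (simp only: inner_add_right inner_scaleR_right mult_1_right)
  qed
  define \<sigma> where "\<sigma> = \<alpha> + \<beta>"
  \<comment> \<open>The two sums share the leading term and, by \<open>lin\<close>, the linear term;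
    \<open>K\<close> is the value at \<open>p\<close>, nonzero because \<open>p\<close> is off the
    quadric.\<close>
  have "K * (\<alpha> + \<beta>) = K * (\<gamma> + \<delta>)" using 1 2 unfolding lin by linarith
  then have \<sigma>: "\<gamma> + \<delta> = \<sigma>" using K by (simp add: \<sigma>_def)
  have "\<sigma> \<noteq> 0"
  proof
    assume "\<sigma> = 0"
    then have "\<alpha> = 0" "\<beta> = 0" using nn by (auto simp: \<sigma>_def)
    then show False using wt by simp
  qed
  then have pos: "\<sigma> > 0" using nn by (simp add: \<sigma>_def)
  have s': "1 - \<beta> / \<sigma> = \<alpha> / \<sigma>" using pos by (simp add: \<sigma>_def field_simps)
  have t': "1 - \<delta> / \<sigma> = \<gamma> / \<sigma>" using pos \<sigma> by (simp add: field_simps)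
  show ?thesis
  proof (rule that[of "\<beta> / \<sigma>" "\<delta> / \<sigma>"])
    show "\<beta> / \<sigma> \<in> {0..1}" "\<delta> / \<sigma> \<in> {0..1}" using pos nn \<sigma> by (auto simp: \<sigma>_def field_simps)
    have "\<alpha> *\<^sub>R a + \<beta> *\<^sub>R b - \<sigma> *\<^sub>R p = \<gamma> *\<^sub>R c + \<delta> *\<^sub>R d - \<sigma> *\<^sub>R p"
    proof -
      have "\<alpha> *\<^sub>R a + \<beta> *\<^sub>R b - \<sigma> *\<^sub>R p = \<alpha> *\<^sub>R (a - p) + \<beta> *\<^sub>R (b - p)"
        by (simp add: \<sigma>_def scaleR_diff_right scaleR_left_distrib)
      also have "\<dots> = \<gamma> *\<^sub>R c + \<delta> *\<^sub>R d - \<sigma> *\<^sub>R p"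
        unfolding lin \<sigma>[symmetric] by (simp add: scaleR_diff_right scaleR_left_distrib)
      finally show ?thesis .
    qed
    then have "\<alpha> *\<^sub>R a + \<beta> *\<^sub>R b = \<gamma> *\<^sub>R c + \<delta> *\<^sub>R d" by simp
    then have "(1 / \<sigma>) *\<^sub>R (\<alpha> *\<^sub>R a + \<beta> *\<^sub>R b) = (1 / \<sigma>) *\<^sub>R (\<gamma> *\<^sub>R c + \<delta> *\<^sub>R d)" by simp
    then show "(1 - \<beta> / \<sigma>) *\<^sub>R a + (\<beta> / \<sigma>) *\<^sub>R b = (1 - \<delta> / \<sigma>) *\<^sub>R c + (\<delta> / \<sigma>) *\<^sub>R d"
      unfolding s' t' by (simp add: scaleR_add_right)
    show "\<beta> / \<sigma> = 0 \<Longrightarrow> s = 0" "\<delta> / \<sigma> = 0 \<Longrightarrow> t = 0" using pos N by (auto simp: \<beta>_def \<delta>_def)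
    show "s = 1" if "\<beta> / \<sigma> = 1"
    proof -
      have "\<alpha> / \<sigma> = 0" using s' that by linarith
      then show ?thesis using pos N by (auto simp: \<alpha>_def)
    qed
    show "t = 1" if "\<delta> / \<sigma> = 1"
    proof -
      have "\<gamma> / \<sigma> = 0" using t' that by linarith
      then show ?thesis using pos N by (auto simp: \<gamma>_def)
    qed
  qed
qed

text \<open>A crossing of inverted edges yields a common point of the original edges, which must be
  a shared vertex, so \<open>s'\<close> and \<open>t'\<close> are 0 or 1. The endpoint clauses of
  \<open>inversion_crossing\<close> carry this back to \<open>s\<close> and \<open>t\<close>, so the
  inverted edges also meet only at vertices. Adjacent edges need a quadric too, since they could
  otherwise overlap after inversion.\<close>

lemma polygonal_knot_inversion:
  assumes K: "polygonal_knot vs" and r: "r > 0" and p: "p \<notin> set vs"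
    and quad: "\<And>i j. i < length vs \<Longrightarrow> j < length vs \<Longrightarrow> i \<noteq> j \<Longrightarrow> \<exists>A b C. p \<notin> quadric A b C \<and>
      {vs ! i, vs ! (Suc i mod length vs), vs ! j, vs ! (Suc j mod length vs)} \<subseteq> quadric A b C"
  shows "polygonal_knot (polygonal_inversion p r vs)"
proof -
  let ?n = "length vs" and ?f = "sphere_inversion p r"
  let ?ws = "polygonal_inversion p r vs"
  have n: "?n \<ge> 3" "distinct vs" using K by (auto simp: polygonal_knot_def)
  have len: "length ?ws = ?n" by (simp add: polygonal_inversion_def)
  have suc: "Suc i mod ?n < ?n" for i using n by (intro mod_less_divisor) linarith
  have sucne: "Suc i mod ?n \<noteq> i" if "i < ?n" for i using n that by (auto simp: mod_Suc)
  have nth: "?ws ! i = ?f (vs ! i)" if "i < ?n" for i using that by (simp add: polygonal_inversion_def)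
  have ne: "vs ! i \<noteq> p" if "i < ?n" for i using p that by auto
  have "inj_on ?f (set vs)" using p sphere_inversion_inj[OF r] by (intro inj_onI) metis
  then have dist: "distinct ?ws" using n by (simp add: polygonal_inversion_def distinct_map)
  have "polygon_edge ?ws i \<inter> polygon_edge ?ws j = {?ws ! i, ?ws ! (Suc i mod ?n)} \<inter> {?ws ! j, ?ws ! (Suc j mod ?n)}"
    if ij: "i < ?n" "j < ?n" "i \<noteq> j" for i j
  proof
    show "{?ws ! i, ?ws ! (Suc i mod ?n)} \<inter> {?ws ! j, ?ws ! (Suc j mod ?n)} \<subseteq> polygon_edge ?ws i \<inter> polygon_edge ?ws j"
      by (auto simp: polygon_edge_def len)
    show "polygon_edge ?ws i \<inter> polygon_edge ?ws j \<subseteq> {?ws ! i, ?ws ! (Suc i mod ?n)} \<inter> {?ws ! j, ?ws ! (Suc j mod ?n)}"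
    proof
      fix x assume x: "x \<in> polygon_edge ?ws i \<inter> polygon_edge ?ws j"
      define a b c d where "a = vs ! i" and "b = vs ! (Suc i mod ?n)" and "c = vs ! j" and "d = vs ! (Suc j mod ?n)"
      have w: "?ws ! i = ?f a" "?ws ! (Suc i mod ?n) = ?f b" "?ws ! j = ?f c" "?ws ! (Suc j mod ?n) = ?f d"
        using ij suc nth by (auto simp: a_def b_def c_def d_def)
      have abcd: "a \<noteq> b" "c \<noteq> d"
        using sucne[OF ij(1)] sucne[OF ij(2)] ij suc n(2) unfolding a_def b_def c_def d_def
        by (metis nth_eq_iff_index_eq)+
      obtain s where s: "s \<in> {0..1}" "x = (1 - s) *\<^sub>R ?f a + s *\<^sub>R ?f b"
        using x unfolding polygon_edge_segment_point segment_point_def len w by blast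
      obtain t where t: "t \<in> {0..1}" "x = (1 - t) *\<^sub>R ?f c + t *\<^sub>R ?f d"
        using x unfolding polygon_edge_segment_point segment_point_def len w by blast
      obtain A v C where q: "p \<notin> quadric A v C" "{a, b, c, d} \<subseteq> quadric A v C"
        using quad[OF ij] unfolding a_def b_def c_def d_def by blast
      have pp: "p \<notin> {a, b, c, d}" using ne ij suc by (auto simp: a_def b_def c_def d_def)
      have cross: "(1 - s) *\<^sub>R ?f a + s *\<^sub>R ?f b = (1 - t) *\<^sub>R ?f c + t *\<^sub>R ?f d"
        using s(2) t(2) by (rule trans[OF sym])
      obtain s' t' where s't': "s' \<in> {0..1}" "t' \<in> {0..1}"
        and eq: "(1 - s') *\<^sub>R a + s' *\<^sub>R b = (1 - t') *\<^sub>R c + t' *\<^sub>R d"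
        and ends: "s' = 0 \<Longrightarrow> s = 0" "s' = 1 \<Longrightarrow> s = 1" "t' = 0 \<Longrightarrow> t = 0" "t' = 1 \<Longrightarrow> t = 1"
        by (rule inversion_crossing[OF pp r s(1) t(1) cross q(2,1)]) blast
      define y where "y = (1 - s') *\<^sub>R a + s' *\<^sub>R b"
      have "y = segment_point vs i s'" "y = segment_point vs j t'"
        by (simp_all add: segment_point_def y_def eq[unfolded a_def b_def c_def d_def] a_def b_def)
      then have "y \<in> polygon_edge vs i" "y \<in> polygon_edge vs j"
        using s't' unfolding polygon_edge_segment_point by blast+
      then have y: "y \<in> {a, b} \<inter> {c, d}"
        using K ij unfolding polygonal_knot_def a_def b_def c_def d_def by blast
      have e1: "s' = 0 \<or> s' = 1"
      proof -
        have "y - a = s' *\<^sub>R (b - a)" "y - b = (s' - 1) *\<^sub>R (b - a)" by (simp_all add: y_def algebra_simps)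
        then show ?thesis using y abcd by auto
      qed
      have e2: "t' = 0 \<or> t' = 1"
      proof -
        have "y - c = t' *\<^sub>R (d - c)" "y - d = (t' - 1) *\<^sub>R (d - c)" unfolding y_def eq by (simp_all add: algebra_simps)
        then show ?thesis using y abcd by auto
      qed
      have "x \<in> {?f a, ?f b}" using e1 ends(1,2) s(2) by auto
      moreover have "x \<in> {?f c, ?f d}" using e2 ends(3,4) t(2) by auto
      ultimately show "x \<in> {?ws ! i, ?ws ! (Suc i mod ?n)} \<inter> {?ws ! j, ?ws ! (Suc j mod ?n)}"
        unfolding w by blast
    qed
  qed
  then show ?thesis unfolding polygonal_knot_def len using n dist by blast
qed

text \<open>Each inverted vertex depends continuously on the centre away from the original vertex,
  and \<open>polygonal_knot_stable\<close> applies to finitely many small displacements.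
  Embeddedness is assumed only at \<open>p\<close>, so the lemma covers centres on the quadrics as
  well.\<close>

lemma polygonal_inversion_locally_constant:
  assumes p: "p \<notin> set vs" and K: "polygonal_knot (polygonal_inversion p r vs)"
  shows "\<exists>V. open V \<and> p \<in> V \<and> (\<forall>q\<in>V. knot_type (closed_polygon (polygonal_inversion q r vs)) =
    knot_type (closed_polygon (polygonal_inversion p r vs)))"
proof -
  let ?n = "length vs"
  obtain e where e: "e > 0" and st: "\<And>ws. length ws = length (polygonal_inversion p r vs) \<Longrightarrow>
    (\<And>i. i < length (polygonal_inversion p r vs) \<Longrightarrow> dist (ws ! i) (polygonal_inversion p r vs ! i) < e) \<Longrightarrow>
    ambient_isotopic (closed_polygon (polygonal_inversion p r vs)) (closed_polygon ws)"
    by (rule polygonal_knot_stable[OF K]) blast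
  have "\<forall>\<^sub>F q in nhds p. dist (sphere_inversion q r x) (sphere_inversion p r x) < e" if "x \<in> set vs" for x
  proof -
    have "x - p \<noteq> 0" using p that by auto
    then have "isCont (\<lambda>q. sphere_inversion q r x) p"
      unfolding sphere_inversion_def by (intro continuous_intros) auto
    then have "((\<lambda>q. sphere_inversion q r x) \<longlongrightarrow> sphere_inversion p r x) (nhds p)"
      by (simp add: isCont_def tendsto_nhds_iff)
    then show ?thesis using e by (rule tendstoD)
  qed
  then have "\<forall>\<^sub>F q in nhds p. \<forall>x\<in>set vs. dist (sphere_inversion q r x) (sphere_inversion p r x) < e"
    by (intro eventually_ball_finite) auto
  then obtain V where V: "open V" "p \<in> V"
    "\<And>q x. q \<in> V \<Longrightarrow> x \<in> set vs \<Longrightarrow> dist (sphere_inversion q r x) (sphere_inversion p r x) < e"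
    unfolding eventually_nhds by blast
  have "ambient_isotopic (closed_polygon (polygonal_inversion p r vs)) (closed_polygon (polygonal_inversion q r vs))"
    if "q \<in> V" for q
    using V(3)[OF that] by (intro st) (auto simp: polygonal_inversion_def)
  then show ?thesis using V(1,2) by (intro exI[of _ V]) (auto dest!: knot_type_eqI)
qed

lemma polygonal_inversion_radius:
  assumes r: "r > 0"
  shows "knot_type (closed_polygon (polygonal_inversion p 1 vs)) = knot_type (closed_polygon (polygonal_inversion p r vs))"
proof (rule knot_type_eqI, rule ambient_isotopicI)
  \<comment> \<open>The ratio of a homothety about \<open>p\<close>, going linearly from 1 to
    \<open>r\<^sup>2\<close> and staying positive.\<close>
  define c where "c t = 1 + t * (r\<^sup>2 - 1)" for t :: real
  define H where "H t x = p + c t *\<^sub>R (x - p)" for t x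
  have c: "c t > 0" if "t \<in> {0..1}" for t
  proof -
    have "c t = (1 - t) + t * r\<^sup>2" by (simp add: c_def algebra_simps)
    moreover have "(1 - t) + t * r\<^sup>2 > 0"
      using that r by (cases "t = 0") (auto intro: add_nonneg_pos)
    ultimately show ?thesis by simp
  qed
  have "continuous_on ({0..1} \<times> UNIV) (\<lambda>x. H (fst x) (snd x))"
    unfolding H_def c_def by (intro continuous_intros)
  then show "continuous_on ({0..1} \<times> UNIV) (\<lambda>(t, x). H t x)" by (simp add: case_prod_unfold)
  show "H 0 = id" by (auto simp: H_def c_def)
  show "\<exists>g. homeomorphism UNIV UNIV (H t) g" if "t \<in> {0..1}" for t
  proof (rule exI[of _ "\<lambda>x. p + (1 / c t) *\<^sub>R (x - p)"])
    show "homeomorphism UNIV UNIV (H t) (\<lambda>x. p + (1 / c t) *\<^sub>R (x - p))"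
      unfolding H_def using c[OF that] by (intro homeomorphismI continuous_intros) auto
  qed
  have inv: "H 1 (sphere_inversion p 1 x) = sphere_inversion p r x" for x
    by (simp add: H_def c_def sphere_inversion_def)
  let ?ws = "polygonal_inversion p 1 vs" and ?us = "polygonal_inversion p r vs"
  have seg: "H 1 (segment_point ?ws j s) = segment_point ?us j s" if j: "j < length vs" for j s
  proof -
    have m: "Suc j mod length vs < length vs" using j by (intro mod_less_divisor) linarith
    have "H 1 ((1 - s) *\<^sub>R x + s *\<^sub>R y) = (1 - s) *\<^sub>R H 1 x + s *\<^sub>R H 1 y" for x y
      by (simp add: H_def algebra_simps)
    then show ?thesis using j m inv by (simp add: segment_point_def polygonal_inversion_def)
  qed
  have len: "length ?ws = length vs" "length ?us = length vs" by (simp_all add: polygonal_inversion_def)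
  show "H 1 ` closed_polygon ?ws = closed_polygon ?us"
    unfolding closed_polygon_segment_point len image_image using seg by (intro image_cong) auto
qed

text \<open>The edges \<open>0\<close> and \<open>n - 1\<close> are adjacent.\<close>

definition disjoint_edge_pairs :: "nat \<Rightarrow> (nat \<times> nat) set" where
  "disjoint_edge_pairs n = {(k, l). Suc k < l \<and> l < n} - {(0, n - 1)}"

lemma finite_disjoint_edge_pairs: "finite (disjoint_edge_pairs n)"
  by (rule finite_subset[of _ "{..<n} \<times> {..<n}"]) (auto simp: disjoint_edge_pairs_def)

text \<open>The count \<open>n(n-3)/2\<close>, written without subtraction or division.\<close>

lemma card_disjoint_edge_pairs:
  assumes "n \<ge> 3"
  shows "2 * card (disjoint_edge_pairs n) + 3 * n = n * n"
proof -
  let ?P = "\<lambda>n. {(k, l). Suc k < l \<and> l < n}"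
  have fin: "finite (?P n)" for n by (rule finite_subset[of _ "{..<n} \<times> {..<n}"]) auto
  \<comment> \<open>Triangular numbers: raising the bound by one adds the pairs with the new largest
    \<open>l\<close>. These pairs still include the adjacent edges \<open>0\<close> and
    \<open>n - 1\<close>, removed at the end.\<close>
  have P: "2 * card (?P (Suc (Suc m))) = Suc m * m" for m
  proof (induction m)
    case 0
    have "?P (Suc (Suc 0)) = {}" by auto
    then show ?case by (simp only: card.empty)
  next
    case (Suc m)
    have eq: "?P (Suc (Suc (Suc m))) = ?P (Suc (Suc m)) \<union> (\<lambda>k. (k, Suc (Suc m))) ` {..<Suc m}"
      by (auto simp: less_Suc_eq)
    have "card (?P (Suc (Suc (Suc m)))) = card (?P (Suc (Suc m))) + card ((\<lambda>k. (k, Suc (Suc m))) ` {..<Suc m})"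
      unfolding eq using fin by (intro card_Un_disjoint) auto
    also have "card ((\<lambda>k. (k, Suc (Suc m))) ` {..<Suc m}) = Suc m"
      by (subst card_image) (auto intro: inj_onI)
    finally show ?case using Suc by simp
  qed
  obtain m where m: "n = Suc (Suc (Suc m))" using assms le_Suc_ex[OF assms] by auto
  have "2 * card (?P n) = Suc (Suc m) * Suc m" unfolding m by (rule P)
  moreover have "(0, n - 1) \<in> ?P n" unfolding m by simp
  then have "card (?P n) = Suc (card (disjoint_edge_pairs n))"
    unfolding disjoint_edge_pairs_def by (rule card.remove[OF fin[of n]])
  ultimately show ?thesis unfolding m by simp
qed

text \<open>Two adjacent edges lie among the four vertices of the pair consisting of the first of them and
  the successor of the second, whose quadric thus also controls their overlaps.\<close>

lemma edges_covered_by_disjoint_pair: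
  assumes n: "n \<ge> 4" and ij: "i < n" "j < n" "i \<noteq> j"
  shows "\<exists>k l. (k, l) \<in> disjoint_edge_pairs n \<and>
    {i, Suc i mod n, j, Suc j mod n} \<subseteq> {k, Suc k mod n, l, Suc l mod n}"
proof -
  have *: "\<exists>k l. (k, l) \<in> disjoint_edge_pairs n \<and>
    {i, Suc i mod n, j, Suc j mod n} \<subseteq> {k, Suc k mod n, l, Suc l mod n}"
    if ij: "i < j" "j < n" for i j
  proof -
    \<comment> \<open>The second and third cases are adjacent edges around the end of the list. In
      the first three cases \<open>n \<ge> 4\<close> ensures that the chosen pair is really
      disjoint.\<close>
    consider "j = Suc i" "Suc j < n" | "j = Suc i" "Suc j = n" | "i = 0" "j = n - 1"
      | "j \<noteq> Suc i" "\<not> (i = 0 \<and> j = n - 1)" using ij by linarith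
    then show ?thesis
    proof cases
      case 1
      then show ?thesis using n by (intro exI[of _ i] exI[of _ "Suc j"]) (auto simp: disjoint_edge_pairs_def)
    next
      case 2
      then show ?thesis using n by (intro exI[of _ 0] exI[of _ i]) (auto simp: disjoint_edge_pairs_def)
    next
      case 3
      then show ?thesis using n by (intro exI[of _ 1] exI[of _ j]) (auto simp: disjoint_edge_pairs_def)
    next
      case 4
      then show ?thesis using ij by (intro exI[of _ i] exI[of _ j]) (auto simp: disjoint_edge_pairs_def)
    qed
  qed
  show ?thesis
  proof (cases "i < j")
    case True then show ?thesis using * ij by blast
  next
    case False
    then have "j < i" using ij by simp
    from *[OF this ij(1)] show ?thesis by (simp only: insert_commute)
  qed
qed

text \<open>The polynomial is the sphere count evaluated at \<open>m = n(n-3)/2\<close>. At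
  \<open>n = 3\<close> there are no disjoint edges and it vanishes, although a triangle inverted at
  a general centre is again a triangle; hence \<open>n \<ge> 4\<close>.\<close>

theorem corollary6:
  fixes vs :: "(real^3) list" and n :: nat
  assumes "polygonal_knot vs" and "length vs = n" and "n \<ge> 4"
  shows "finite (inversion_knot_types vs) \<and>
         real (card (inversion_knot_types vs)) \<le>
           (real n ^ 6 - 9 * real n ^ 5 + 21 * real n ^ 4 + 9 * real n ^ 3
              - 22 * real n ^ 2 - 96 * real n) / 24"
proof -
  let ?I = "disjoint_edge_pairs n"
  have "\<forall>x. \<exists>q. (case q of (A, b, C) \<Rightarrow> (A, b, C) \<noteq> (0, 0, 0) \<and>
      {vs ! fst x, vs ! (Suc (fst x) mod n), vs ! snd x, vs ! (Suc (snd x) mod n)} \<subseteq> quadric A b C)"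
  proof
    fix x
    obtain A b C where "(A, b, C) \<noteq> (0, 0, 0)"
      "{vs ! fst x, vs ! (Suc (fst x) mod n), vs ! snd x, vs ! (Suc (snd x) mod n)} \<subseteq> quadric A b C"
      by (rule quadric_through_four_points)
    then show "\<exists>q. case q of (A, b, C) \<Rightarrow> (A, b, C) \<noteq> (0, 0, 0) \<and>
      {vs ! fst x, vs ! (Suc (fst x) mod n), vs ! snd x, vs ! (Suc (snd x) mod n)} \<subseteq> quadric A b C"
      by (intro exI[of _ "(A, b, C)"]) simp
  qed
  from choice[OF this] obtain q where q: "\<And>x. case q x of (A, b, C) \<Rightarrow> (A, b, C) \<noteq> (0, 0, 0) \<and>
      {vs ! fst x, vs ! (Suc (fst x) mod n), vs ! snd x, vs ! (Suc (snd x) mod n)} \<subseteq> quadric A b C" by blast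
  define A b C where "A x = fst (q x)" and "b x = fst (snd (q x))" and "C x = snd (snd (q x))" for x
  have nz: "(A x, b x, C x) \<noteq> (0, 0, 0)"
    and through: "{vs ! fst x, vs ! (Suc (fst x) mod n), vs ! snd x, vs ! (Suc (snd x) mod n)} \<subseteq> quadric (A x) (b x) (C x)" for x
    using q[of x] by (auto simp: A_def b_def C_def split: prod.splits)
  define X where "X = off_quadrics ?I A b C"
  have quad: "\<exists>A b C. p \<notin> quadric A b C \<and>
      {vs ! i, vs ! (Suc i mod n), vs ! j, vs ! (Suc j mod n)} \<subseteq> quadric A b C"
    if p: "p \<in> X" and ij: "i < n" "j < n" "i \<noteq> j" for p i j
  proof -
    obtain k l where kl: "(k, l) \<in> ?I" "{i, Suc i mod n, j, Suc j mod n} \<subseteq> {k, Suc k mod n, l, Suc l mod n}"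
      using edges_covered_by_disjoint_pair[OF assms(3) ij] by blast
    have "{vs ! i, vs ! (Suc i mod n), vs ! j, vs ! (Suc j mod n)} = (!) vs ` {i, Suc i mod n, j, Suc j mod n}" by simp
    also have "\<dots> \<subseteq> (!) vs ` {k, Suc k mod n, l, Suc l mod n}" using kl(2) by (rule image_mono)
    also have "\<dots> \<subseteq> quadric (A (k, l)) (b (k, l)) (C (k, l))" using through[of "(k, l)"] by simp
    finally have "{vs ! i, vs ! (Suc i mod n), vs ! j, vs ! (Suc j mod n)} \<subseteq> quadric (A (k, l)) (b (k, l)) (C (k, l))" .
    moreover have "p \<notin> quadric (A (k, l)) (b (k, l)) (C (k, l))" using p kl(1) by (simp add: X_def off_quadrics_def)
    ultimately show ?thesis by blast
  qed
  \<comment> \<open>Every vertex lies on the quadric of some pair of edges, so centres off all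
    quadrics are never vertices.\<close>
  have vs: "p \<notin> set vs" if pX: "p \<in> X" for p
  proof
    assume "p \<in> set vs"
    then obtain i where i: "i < n" "p = vs ! i" using assms(2) by (auto simp: in_set_conv_nth)
    have "Suc i mod n < n" "Suc i mod n \<noteq> i" using assms(3) i(1) by (auto simp: mod_Suc)
    then obtain A b C where "p \<notin> quadric A b C" "vs ! i \<in> quadric A b C"
      using quad[OF pX i(1), of "Suc i mod n"] by auto
    then show False using i(2) by simp
  qed
  have knot: "polygonal_knot (polygonal_inversion p 1 vs)" if "p \<in> X" for p
    using polygonal_knot_inversion[OF assms(1) zero_less_one vs[OF that]] quad[OF that] assms(2) by simp
  define f where "f p = knot_type (closed_polygon (polygonal_inversion p 1 vs))" for p
  have loc: "\<exists>V. open V \<and> p \<in> V \<and> (\<forall>q\<in>V \<inter> X. f q = f p)" if "p \<in> X" for p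
    using polygonal_inversion_locally_constant[OF vs[OF that] knot[OF that]] unfolding f_def by blast
  have "pieces_le X (space_regions (card ?I))"
    unfolding X_def by (rule pieces_le_off_quadrics_space[OF finite_disjoint_edge_pairs])
  then have card: "finite (f ` X)" "card (f ` X) \<le> space_regions (card ?I)"
    using pieces_le_locally_constant loc by blast+
  have dense: "closure X = UNIV"
    unfolding X_def using finite_disjoint_edge_pairs nz by (rule closure_off_quadrics)
  have sub: "inversion_knot_types vs \<subseteq> f ` X"
  proof
    fix T assume "T \<in> inversion_knot_types vs"
    then obtain p r where T: "T = knot_type (closed_polygon (polygonal_inversion p r vs))"
      and r: "r > 0" "p \<notin> set vs" "polygonal_knot (polygonal_inversion p r vs)"
      unfolding inversion_knot_types_def by blast
    obtain V where V: "open V" "p \<in> V" "\<forall>q\<in>V. knot_type (closed_polygon (polygonal_inversion q r vs)) = T"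
      using polygonal_inversion_locally_constant[OF r(2,3)] T by blast
    obtain q where "q \<in> V" "q \<in> X"
      using open_Int_closure_eq_empty[OF V(1), of X] dense V(2) by blast
    then show "T \<in> f ` X" using V(3) polygonal_inversion_radius[OF r(1)] by (auto simp: f_def)
  qed
  have fin: "finite (inversion_knot_types vs)" using sub card(1) by (rule finite_subset)
  have "card (inversion_knot_types vs) \<le> card (f ` X)" using card_mono[OF card(1) sub] .
  then have le: "real (card (inversion_knot_types vs)) \<le> real (space_regions (card ?I))" using card(2) by linarith
  have cI: "2 * card ?I + 3 * n = n * n" using card_disjoint_edge_pairs assms(3) by simp
  \<comment> \<open>There is at least one disjoint pair, which puts the number of quadrics in the
    range where the closed form holds.\<close>
  have "4 * n \<le> n * n" using assms(3) by simp
  then have "card ?I \<noteq> 0" using cI assms(3) by linarith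
  then obtain m where m: "card ?I = Suc m" using not0_implies_Suc by blast
  define x where "x = real (card ?I)"
  have "real (2 * card ?I + 3 * n) = real (n * n)" unfolding cI ..
  then have x: "x = (real n * real n - 3 * real n) / 2" by (simp add: x_def)
  have "real (space_regions (card ?I)) = (x ^ 3 - 3 * x ^ 2 + 8 * x) / 3"
    unfolding x_def m by (rule real_space_regions)
  also have "\<dots> = (real n ^ 6 - 9 * real n ^ 5 + 21 * real n ^ 4 + 9 * real n ^ 3
              - 22 * real n ^ 2 - 96 * real n) / 24"
    unfolding x by (simp add: field_simps power2_eq_square power3_eq_cube eval_nat_numeral)
  finally show ?thesis using fin le by simp
qed

thm_deps corollary6

end
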